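(* Let $A$ be a regular weak multiplier Hopf algebra. If $A$ is both of compact type and of discrete type, then $A$ is finite-dimensional.
   Context: All algebras are over $\mathbb{C}$, associative, possibly non-unital, with non-degenerate product. $A$ is idempotent if $A^2=A$; $M(A)$ is the multiplier algebra (identity $1$); $A'$ is the space of all linear functionals on $A$. A coproduct is a homomorphism $\Delta:A\to M(A\otimes A)$ with $\Delta(a)(1\otimes b),(a\otimes 1)\Delta(b)\in A\otimes A$, coassociative: $(a\otimes1\otimes1)(\Delta\otimes id)(\Delta(b)(1\otimes c))=(id\otimes\Delta)((a\otimes1)\Delta(b))(1\otimes1\otimes c)$. Put $T_1(a\otimes b)=\Delta(a)(1\otimes b)$, $T_2(a\otimes b)=(a\otimes1)\Delta(b)$. $\Delta$ is full if the smallest subspaces $V,W\subset A$ with $\Delta(A)(1\otimes A)\subset V\otimes A$ and $(A\otimes1)\Delta(A)\subset A\otimes W$ both equal $A$. A counit is a linear functional $\varepsilon$ with $(\varepsilon\otimes id)(\Delta(a)(1\otimes b))=ab$, $(id\otimes\varepsilon)((c\otimes1)\Delta(a))=ca$. A weak multiplier Hopf algebra is a non-degenerate idempotent algebra $A$ with a full coproduct $\Delta$ and a counit such that: (i) there is an idempotent $E\in M(A\otimes A)$ with $T_1(A\otimes A)=E(A\otimes A)$, $T_2(A\otimes A)=(A\otimes A)E$; (ii) $(id\otimes\Delta)E=(E\otimes1)(1\otimes E)=(1\otimes E)(E\otimes1)$; (iii) $\mathrm{Ker}(T_i)=(1-G_i)(A\otimes A)$, $i=1,2$, where $G_1,G_2$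 are the linear maps on $A\otimes A$ given by $(G_1\otimes id)(\Delta_{13}(a)(1\otimes b\otimes c))=\Delta_{13}(a)(1\otimes E)(1\otimes b\otimes c)$ and $(id\otimes G_2)((a\otimes b\otimes1)\Delta_{13}(c))=(a\otimes b\otimes1)(E\otimes1)\Delta_{13}(c)$. Here $\Delta$ (and likewise $id\otimes\Delta$) is uniquely extended to multipliers, with $\Delta(1)=E$. With Sweedler notation $\Delta(a)=\sum a_{(1)}\otimes a_{(2)}$, the antipode $S$ is the non-degenerate anti-homomorphism $A\to M(A)$ with $E(a\otimes b)=\sum a_{(1)}\otimes a_{(2)}S(a_{(3)})b$, $(a\otimes b)E=\sum aS(b_{(1)})b_{(2)}\otimes b_{(3)}$, $G_1(a\otimes b)=\sum a_{(1)}\otimes S(a_{(2)})a_{(3)}b$, $G_2(a\otimes b)=\sum ab_{(1)}S(b_{(2)})\otimes b_{(3)}$, $\sum S(a_{(1)})a_{(2)}S(a_{(3)})=S(a)$; it extends to $M(A)$. $A$ is regular if $S$ is bijective from $A$ to $A$; then also $\Delta(a)(b\otimes1),(1\otimes a)\Delta(b)\in A\otimes A$. Put $\varepsilon_t(a)=\sum a_{(1)}S(a_{(2)})$, $A_t=\{x\in M(A):\Delta(x)=(x\otimes1)E\}$. A left integral is a non-zero $\varphi\in A'$ with $(id\otimes\varphi)\Delta(a)\in A_t$ for all $a\in A$ (the slice being the multiplier of $A$ obtained after multiplying on either side by $b\otimes1$). The set of left integrals is faithful if: $\varphi(xa)=0$ for all left integrals $\varphi$ and $a\in A$ implies $x=0$,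 and $\varphi(ax)=0$ for all such $\varphi,a$ implies $x=0$. $A$ is of compact type if it is a regular weak multiplier Hopf algebra with a faithful set of integrals and $A$ has an identity. A left cointegral is a non-zero $h\in M(A)$ with $ah=\varepsilon_t(a)h$ for all $a\in A$; $H$ is the space of left cointegrals in $A$ (with $0$). The left (right) leg of $\Delta(H)$ is the smallest subspace $V$ (resp. $W$) of $A$ with $\Delta(h)(1\otimes a)\in V\otimes A$ (resp. $(a\otimes1)\Delta(h)\in A\otimes W$) for all $a\in A$, $h\in H$. $H$ is a faithful set of left cointegrals if both legs equal $A$; $A$ is of discrete type if it has a faithful set of left cointegrals. *)

theory Defs
  imports Complex_Main "HOL-Library.Poly_Mapping"
begin

section \<open>Complex vector spaces and possibly non-unital algebras\<close>

class complex_vector = ab_group_add +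
  fixes scaleC :: "complex \<Rightarrow> 'a \<Rightarrow> 'a"  (infixr "*\<^sub>C" 75)
  assumes scaleC_add_right: "c *\<^sub>C (x + y) = c *\<^sub>C x + c *\<^sub>C y"
    and scaleC_add_left: "(c + d) *\<^sub>C x = c *\<^sub>C x + d *\<^sub>C x"
    and scaleC_scaleC: "c *\<^sub>C d *\<^sub>C x = (c * d) *\<^sub>C x"
    and scaleC_one: "1 *\<^sub>C x = x"

class complex_algebra = complex_vector + ring +
  assumes mult_scaleC_left: "(c *\<^sub>C x) * y = c *\<^sub>C (x * y)"
    and mult_scaleC_right: "x * (c *\<^sub>C y) = c *\<^sub>C (x * y)"

global_interpretation cvec: vector_space "scaleC :: complex \<Rightarrow> 'a \<Rightarrow> 'a::complex_vector"
  by unfold_locales (rule scaleC_add_right scaleC_add_left scaleC_scaleC scaleC_one)+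

abbreviation clinear :: "('a::complex_vector \<Rightarrow> 'b::complex_vector) \<Rightarrow> bool" where
  "clinear f \<equiv> Vector_Spaces.linear scaleC scaleC f"

lemma clinearI:
  assumes "\<And>x y. f (x + y) = f x + f y" and "\<And>c x. f (c *\<^sub>C x) = c *\<^sub>C f x"
  shows "clinear f"
  using assms
  by (auto simp: Vector_Spaces.linear_def module_hom_def module_hom_axioms_def
      intro: cvec.vector_space_axioms cvec.module_axioms)

lemma clinear_add: "clinear f \<Longrightarrow> f (x + y) = f x + f y"
  by (auto simp: Vector_Spaces.linear_def module_hom_def module_hom_axioms_def)

lemma clinear_scale: "clinear f \<Longrightarrow> f (c *\<^sub>C x) = c *\<^sub>C f x"
  by (auto simp: Vector_Spaces.linear_def module_hom_def module_hom_axioms_def)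

lemma clinear_zero: "clinear f \<Longrightarrow> f 0 = 0"
  using clinear_add[of f 0 0] by simp

lemma clinear_diff: "clinear f \<Longrightarrow> f (x - y) = f x - f y"
  using clinear_add[of f "x - y" y] by (simp add: algebra_simps)

instantiation complex :: complex_algebra
begin
definition scaleC_complex :: "complex \<Rightarrow> complex \<Rightarrow> complex" where
  "scaleC_complex = (*)"
instance
  by standard (simp_all add: scaleC_complex_def algebra_simps)
end

definition cbilinear :: "('a::complex_vector \<Rightarrow> 'b::complex_vector \<Rightarrow> 'c::complex_vector) \<Rightarrow> bool" where
  "cbilinear f \<longleftrightarrow> (\<forall>a. clinear (f a)) \<and> (\<forall>b. clinear (\<lambda>a. f a b))"

lemma cbilinearI:
  assumes "\<And>x y b. f (x + y) b = f x b + f y b" and "\<And>c x b. f (c *\<^sub>C x) b = c *\<^sub>C f x b"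
    and "\<And>a x y. f a (x + y) = f a x + f a y" and "\<And>a c x. f a (c *\<^sub>C x) = c *\<^sub>C f a x"
  shows "cbilinear f"
  unfolding cbilinear_def using assms by (auto intro!: clinearI)

lemma cbilinearD:
  assumes "cbilinear f"
  shows "f (x + y) b = f x b + f y b" "f (c *\<^sub>C x) b = c *\<^sub>C f x b"
    "f a (u + v) = f a u + f a v" "f a (c *\<^sub>C u) = c *\<^sub>C f a u"
proof -
  have 1: "clinear (\<lambda>a. f a b)" and 2: "clinear (f a)"
    using assms by (auto simp: cbilinear_def)
  show "f (x + y) b = f x b + f y b" "f (c *\<^sub>C x) b = c *\<^sub>C f x b"
    using clinear_add[OF 1] clinear_scale[OF 1] by auto
  show "f a (u + v) = f a u + f a v" "f a (c *\<^sub>C u) = c *\<^sub>C f a u"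
    using clinear_add[OF 2] clinear_scale[OF 2] by auto
qed


section \<open>The algebraic tensor product\<close>

instantiation poly_mapping :: (type, complex_vector) complex_vector
begin
lift_definition scaleC_poly_mapping :: "complex \<Rightarrow> ('a \<Rightarrow>\<^sub>0 'b) \<Rightarrow> ('a \<Rightarrow>\<^sub>0 'b)"
  is "\<lambda>c f k. c *\<^sub>C f k"
  by (erule finite_subset[rotated]) (auto simp: cvec.scale_zero_right)
instance
  by standard (transfer; simp add: scaleC_add_right scaleC_add_left scaleC_scaleC scaleC_one)+
end

lemma lookup_scaleC: "Poly_Mapping.lookup (c *\<^sub>C p) k = c *\<^sub>C Poly_Mapping.lookup p k"
  by transfer simp

abbreviation free_gen :: "'a \<Rightarrow> 'b \<Rightarrow> ('a \<times> 'b) \<Rightarrow>\<^sub>0 complex" where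
  "free_gen a b \<equiv> Poly_Mapping.single (a, b) 1"

text \<open>The tensor product is the free vector space on the pairs modulo the bilinearity relations.\<close>

inductive_set tensor_relators :: "(('a::complex_vector \<times> 'b::complex_vector) \<Rightarrow>\<^sub>0 complex) set" where
  "free_gen (a + a') b - free_gen a b - free_gen a' b \<in> tensor_relators"
| "free_gen a (b + b') - free_gen a b - free_gen a b' \<in> tensor_relators"
| "free_gen (c *\<^sub>C a) b - c *\<^sub>C free_gen a b \<in> tensor_relators"
| "free_gen a (c *\<^sub>C b) - c *\<^sub>C free_gen a b \<in> tensor_relators"

definition tensor_rel ::
  "(('a::complex_vector \<times> 'b::complex_vector) \<Rightarrow>\<^sub>0 complex) \<Rightarrow> (('a \<times> 'b) \<Rightarrow>\<^sub>0 complex) \<Rightarrow> bool" where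
  "tensor_rel p q \<longleftrightarrow> p - q \<in> cvec.span tensor_relators"

lemma equivp_tensor_rel: "equivp tensor_rel"
proof (rule equivpI)
  show "reflp tensor_rel"
    by (auto simp: reflp_def tensor_rel_def cvec.span_zero)
  show "symp tensor_rel"
    using cvec.span_neg by (force simp: symp_def tensor_rel_def)
  show "transp tensor_rel"
    using cvec.span_add by (force simp: transp_def tensor_rel_def)
qed

quotient_type (overloaded) ('a, 'b) tensor =
  "('a::complex_vector \<times> 'b::complex_vector) \<Rightarrow>\<^sub>0 complex" / tensor_rel
  by (rule equivp_tensor_rel)

type_notation tensor  (infixr "\<otimes>" 72)

instantiation tensor :: (complex_vector, complex_vector) complex_vector
begin
lift_definition zero_tensor :: "'a \<otimes> 'b" is 0 .
lift_definition plus_tensor :: "'a \<otimes> 'b \<Rightarrow> 'a \<otimes> 'b \<Rightarrow> 'a \<otimes> 'b" is "(+)"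
  by (auto simp: tensor_rel_def add_diff_add intro: cvec.span_add)
lift_definition uminus_tensor :: "'a \<otimes> 'b \<Rightarrow> 'a \<otimes> 'b" is uminus
  unfolding tensor_rel_def by (drule cvec.span_neg) (simp add: algebra_simps)
lift_definition minus_tensor :: "'a \<otimes> 'b \<Rightarrow> 'a \<otimes> 'b \<Rightarrow> 'a \<otimes> 'b" is "(-)"
  unfolding tensor_rel_def by (drule (1) cvec.span_diff) (simp add: algebra_simps)
lift_definition scaleC_tensor :: "complex \<Rightarrow> 'a \<otimes> 'b \<Rightarrow> 'a \<otimes> 'b" is scaleC
  unfolding tensor_rel_def by (simp add: cvec.span_scale flip: cvec.scale_right_diff_distrib)
instance
  by standard (transfer; simp add: tensor_rel_def cvec.span_zero scaleC_add_right scaleC_add_left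
      scaleC_scaleC scaleC_one algebra_simps)+
end

lift_definition tens :: "'a::complex_vector \<Rightarrow> 'b::complex_vector \<Rightarrow> 'a \<otimes> 'b"  (infixr "\<otimes>" 72)
  is "\<lambda>a b. free_gen a b" .

lemma cbilinear_tens: "cbilinear (\<otimes>)"
proof (rule cbilinearI; transfer)
  fix x y :: 'a and b :: 'b and c
  show "tensor_rel (free_gen (x + y) b) (free_gen x b + free_gen y b)"
    unfolding tensor_rel_def diff_diff_eq[symmetric]
    by (intro cvec.span_base tensor_relators.intros)
  show "tensor_rel (free_gen (c *\<^sub>C x) b) (c *\<^sub>C free_gen x b)"
    unfolding tensor_rel_def by (intro cvec.span_base tensor_relators.intros)
next
  fix x y :: 'b and a :: 'a and c
  show "tensor_rel (free_gen a (x + y)) (free_gen a x + free_gen a y)"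
    unfolding tensor_rel_def diff_diff_eq[symmetric]
    by (intro cvec.span_base tensor_relators.intros)
  show "tensor_rel (free_gen a (c *\<^sub>C x)) (c *\<^sub>C free_gen a x)"
    unfolding tensor_rel_def by (intro cvec.span_base tensor_relators.intros)
qed

lemmas tens_simps = cbilinearD[OF cbilinear_tens]

lemma tensor_induct [case_names tens add]:
  assumes "\<And>a b. P (a \<otimes> b)" and "\<And>x y. P x \<Longrightarrow> P y \<Longrightarrow> P (x + y)"
  shows "P t"
proof -
  have "P (abs_tensor p)" for p
  proof (induction p rule: update_induct)
    case const
    have "P (0 \<otimes> 0)" by (rule assms(1))
    moreover have "(0 :: 'a) \<otimes> (0 :: 'b) = 0"
      using tens_simps(2)[of 0 "0 :: 'a" "0 :: 'b"] by simp
    ultimately show ?case by (simp add: zero_tensor.abs_eq)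
  next
    case (update f k v)
    obtain a b where k: "k = (a, b)" by fastforce
    have "Poly_Mapping.update k v f = f + v *\<^sub>C free_gen a b"
      using update(1) unfolding k
      by (intro poly_mapping_eqI)
        (auto simp: lookup_update lookup_add lookup_single lookup_scaleC scaleC_complex_def
          when_def in_keys_iff)
    then have "abs_tensor (Poly_Mapping.update k v f) = abs_tensor f + (v *\<^sub>C a) \<otimes> b"
      by (simp add: tens_simps flip: plus_tensor.abs_eq scaleC_tensor.abs_eq tens.abs_eq)
    then show ?case using assms update by simp
  qed
  then show ?thesis by (metis Quotient_abs_rep Quotient_tensor)
qed

text \<open>The linear map induced by a bilinear map.  On maps that are not bilinear the value of
  \<open>tlift\<close> is irrelevant.\<close>

definition free_lift ::
  "('a \<Rightarrow> 'b \<Rightarrow> 'c::complex_vector) \<Rightarrow> (('a \<times> 'b) \<Rightarrow>\<^sub>0 complex) \<Rightarrow> 'c" where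
  "free_lift f p = (\<Sum>k \<in> Poly_Mapping.keys p. Poly_Mapping.lookup p k *\<^sub>C f (fst k) (snd k))"

definition tlift ::
  "('a::complex_vector \<Rightarrow> 'b::complex_vector \<Rightarrow> 'c::complex_vector) \<Rightarrow> 'a \<otimes> 'b \<Rightarrow> 'c" where
  "tlift f t = free_lift f (rep_tensor t)"

lemma free_lift_superset:
  assumes "finite K" "Poly_Mapping.keys p \<subseteq> K"
  shows "free_lift f p = (\<Sum>k\<in>K. Poly_Mapping.lookup p k *\<^sub>C f (fst k) (snd k))"
  unfolding free_lift_def
  by (rule sum.mono_neutral_left) (use assms in \<open>auto simp: in_keys_iff cvec.scale_zero_left\<close>)

lemma clinear_free_lift: "clinear (free_lift f)"
proof (rule clinearI)
  fix p q :: "('a \<times> 'b) \<Rightarrow>\<^sub>0 complex" and c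
  let ?K = "Poly_Mapping.keys p \<union> Poly_Mapping.keys q \<union> Poly_Mapping.keys (p + q)
    \<union> Poly_Mapping.keys (c *\<^sub>C p)"
  have K: "free_lift f r = (\<Sum>k\<in>?K. Poly_Mapping.lookup r k *\<^sub>C f (fst k) (snd k))"
    if "r \<in> {p, q, p + q, c *\<^sub>C p}" for r
    by (rule free_lift_superset) (use that in auto)
  show "free_lift f (p + q) = free_lift f p + free_lift f q"
    by (simp add: K lookup_add scaleC_add_left sum.distrib)
  show "free_lift f (c *\<^sub>C p) = c *\<^sub>C free_lift f p"
    by (simp add: K lookup_scaleC scaleC_complex_def cvec.scale_sum_right)
qed

lemma free_lift_gen: "free_lift f (free_gen a b) = f a b"
  by (simp add: free_lift_def scaleC_one)

lemma free_lift_relators: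
  assumes f: "cbilinear f" and p: "p \<in> cvec.span tensor_relators"
  shows "free_lift f p = 0"
  using p
proof (induction rule: cvec.span_induct_alt)
  case base
  show ?case by (rule clinear_zero[OF clinear_free_lift])
next
  case (step c x y)
  have "free_lift f x = 0"
    using step(1)
    by cases (simp_all add: clinear_diff[OF clinear_free_lift] clinear_scale[OF clinear_free_lift]
        free_lift_gen cbilinearD[OF f])
  then show ?case
    using step(2) by (simp add: clinear_add[OF clinear_free_lift] clinear_scale[OF clinear_free_lift])
qed

lemma tlift_abs:
  assumes "cbilinear f"
  shows "tlift f (abs_tensor p) = free_lift f p"
proof -
  have "tensor_rel (rep_tensor (abs_tensor p)) p"
    by (metis Quotient_rep_abs Quotient_tensor equivp_reflp equivp_tensor_rel)
  then have "free_lift f (rep_tensor (abs_tensor p) - p) = 0"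
    unfolding tensor_rel_def by (rule free_lift_relators[OF assms])
  then show ?thesis
    by (simp add: tlift_def clinear_diff[OF clinear_free_lift])
qed

lemma tlift_tens: "cbilinear f \<Longrightarrow> tlift f (a \<otimes> b) = f a b"
  by (simp add: tens.abs_eq tlift_abs free_lift_gen)

lemma clinear_tlift:
  assumes "cbilinear f"
  shows "clinear (tlift f)"
proof (rule clinearI)
  fix x y c
  show "tlift f (x + y) = tlift f x + tlift f y"
    by (induction x; induction y)
       (simp add: plus_tensor.abs_eq tlift_abs[OF assms] clinear_add[OF clinear_free_lift])
  show "tlift f (c *\<^sub>C x) = c *\<^sub>C tlift f x"
    by (induction x)
       (simp add: scaleC_tensor.abs_eq tlift_abs[OF assms] clinear_scale[OF clinear_free_lift])
qed


lemma tensor_ext: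
  assumes "clinear f" "clinear g" and "\<And>a b. f (a \<otimes> b) = g (a \<otimes> b)"
  shows "f t = g t"
  by (induction t rule: tensor_induct)
     (simp_all add: assms(3) clinear_add[OF assms(1)] clinear_add[OF assms(2)])

lemma clinear_tlift_param:
  assumes "\<And>x. cbilinear (f x)" and "\<And>a b. clinear (\<lambda>x. f x a b)"
  shows "clinear (\<lambda>x. tlift (f x) t)"
proof (induction t rule: tensor_induct)
  case (tens a b)
  then show ?case using assms by (simp add: tlift_tens)
next
  case (add t u)
  show ?case
    by (rule clinearI)
       (simp_all add: clinear_add[OF clinear_tlift[OF assms(1)]] clinear_add[OF add(1)]
         clinear_add[OF add(2)] clinear_scale[OF add(1)] clinear_scale[OF add(2)] scaleC_add_right)
qed

definition map_tensor ::
  "('a::complex_vector \<Rightarrow> 'c::complex_vector) \<Rightarrow> ('b::complex_vector \<Rightarrow> 'd::complex_vector)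
    \<Rightarrow> 'a \<otimes> 'b \<Rightarrow> 'c \<otimes> 'd" where
  "map_tensor f g = tlift (\<lambda>a b. f a \<otimes> g b)"

lemma cbilinear_map_tensor:
  assumes "clinear f" "clinear g"
  shows "cbilinear (\<lambda>a b. f a \<otimes> g b)"
  by (rule cbilinearI)
     (simp_all add: assms[THEN clinear_add] assms[THEN clinear_scale] tens_simps)

lemma map_tensor_tens:
  "clinear f \<Longrightarrow> clinear g \<Longrightarrow> map_tensor f g (a \<otimes> b) = f a \<otimes> g b"
  by (simp add: map_tensor_def tlift_tens cbilinear_map_tensor)

lemma clinear_map_tensor: "clinear f \<Longrightarrow> clinear g \<Longrightarrow> clinear (map_tensor f g)"
  by (simp add: map_tensor_def clinear_tlift cbilinear_map_tensor)

instantiation tensor :: (complex_algebra, complex_algebra) complex_algebra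
begin

definition times_tensor :: "'a \<otimes> 'b \<Rightarrow> 'a \<otimes> 'b \<Rightarrow> 'a \<otimes> 'b" where
  "t * u = tlift (\<lambda>a b. tlift (\<lambda>c d. (a * c) \<otimes> (b * d)) u) t"

lemma times_tensor_aux1: "cbilinear (\<lambda>c d. ((a::'a) * c) \<otimes> ((b::'b) * d))"
  by (rule cbilinearI) (simp_all add: distrib_left mult_scaleC_right tens_simps)

lemma times_tensor_aux2: "cbilinear (\<lambda>a b. tlift (\<lambda>c d. ((a::'a) * c) \<otimes> ((b::'b) * d)) u)"
  unfolding cbilinear_def
  by (intro conjI allI clinear_tlift_param times_tensor_aux1 clinearI)
     (simp_all add: distrib_right mult_scaleC_left tens_simps)

lemma tens_mult_tens_aux: "((a::'a) \<otimes> (b::'b)) * (c \<otimes> d) = (a * c) \<otimes> (b * d)"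
  unfolding times_tensor_def
  by (subst tlift_tens[OF times_tensor_aux2]) (rule tlift_tens[OF times_tensor_aux1])

lemma cbilinear_times_tensor_aux: "cbilinear ((*) :: 'a \<otimes> 'b \<Rightarrow> _)"
proof -
  have left: "clinear (\<lambda>t. t * u)" for u :: "'a \<otimes> 'b"
    unfolding times_tensor_def by (rule clinear_tlift[OF times_tensor_aux2])
  have right: "clinear (\<lambda>u. t * u)" for t :: "'a \<otimes> 'b"
    unfolding times_tensor_def
    by (rule clinear_tlift_param[OF times_tensor_aux2]) (rule clinear_tlift[OF times_tensor_aux1])
  show ?thesis
    by (simp add: cbilinear_def left right)
qed

instance
proof
  note s = cbilinearD[OF cbilinear_times_tensor_aux]
  fix x y z :: "'a \<otimes> 'b" and c
  have 1: "(a1 \<otimes> b1) * (a2 \<otimes> b2) * t = (a1 \<otimes> b1) * ((a2 \<otimes> b2) * t)"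
    for a1 a2 :: 'a and b1 b2 :: 'b and t
    by (induction t rule: tensor_induct) (simp_all add: tens_mult_tens_aux s mult.assoc)
  have 2: "(a1 \<otimes> b1) * u * t = (a1 \<otimes> b1) * (u * t)"
    for a1 :: 'a and b1 :: 'b and u t
    by (induction u rule: tensor_induct) (simp_all add: 1 s)
  show "x * y * z = x * (y * z)"
    by (induction x rule: tensor_induct) (simp_all add: 2 s)
  show "(x + y) * z = x * z + y * z" "x * (y + z) = x * y + x * z"
    "(c *\<^sub>C x) * y = c *\<^sub>C (x * y)" "x * (c *\<^sub>C y) = c *\<^sub>C (x * y)"
    by (simp_all add: s)
qed

end

lemma tens_mult_tens: "(a \<otimes> b) * (c \<otimes> d) = (a * c) \<otimes> (b * d)"
  for a c :: "'a::complex_algebra" and b d :: "'b::complex_algebra"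
  by (rule tens_mult_tens_aux)

definition tensor_swap :: "'a::complex_vector \<otimes> 'b::complex_vector \<Rightarrow> 'b \<otimes> 'a" where
  "tensor_swap = tlift (\<lambda>a b. b \<otimes> a)"

definition tensor_assoc ::
  "('a::complex_vector \<otimes> 'b::complex_vector) \<otimes> 'c::complex_vector \<Rightarrow> 'a \<otimes> 'b \<otimes> 'c" where
  "tensor_assoc = tlift (\<lambda>t c. tlift (\<lambda>a b. a \<otimes> b \<otimes> c) t)"

definition tensor_unassoc ::
  "'a::complex_vector \<otimes> 'b::complex_vector \<otimes> 'c::complex_vector \<Rightarrow> ('a \<otimes> 'b) \<otimes> 'c" where
  "tensor_unassoc = tlift (\<lambda>a u. tlift (\<lambda>b c. (a \<otimes> b) \<otimes> c) u)"

lemma cbilinear_swap: "cbilinear (\<lambda>a b. b \<otimes> a)"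
  by (rule cbilinearI) (simp_all add: tens_simps)

lemma tensor_swap_tens: "tensor_swap (a \<otimes> b) = b \<otimes> a"
  by (simp add: tensor_swap_def tlift_tens[OF cbilinear_swap])

lemma clinear_tensor_swap: "clinear tensor_swap"
  by (simp add: tensor_swap_def clinear_tlift[OF cbilinear_swap])

lemma cbilinear_assoc1: "cbilinear (\<lambda>a b. a \<otimes> b \<otimes> c)"
  by (rule cbilinearI) (simp_all add: tens_simps)

lemma cbilinear_assoc2: "cbilinear (\<lambda>t c. tlift (\<lambda>a b. a \<otimes> b \<otimes> c) t)"
  unfolding cbilinear_def
  by (intro conjI allI clinear_tlift_param clinear_tlift cbilinear_assoc1 clinearI)
     (simp_all add: tens_simps)

lemma cbilinear_unassoc1: "cbilinear (\<lambda>b c. (a \<otimes> b) \<otimes> c)"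
  by (rule cbilinearI) (simp_all add: tens_simps)

lemma cbilinear_unassoc2: "cbilinear (\<lambda>a u. tlift (\<lambda>b c. (a \<otimes> b) \<otimes> c) u)"
  unfolding cbilinear_def
  by (intro conjI allI clinear_tlift_param clinear_tlift cbilinear_unassoc1 clinearI)
     (simp_all add: tens_simps)

lemma tensor_assoc_tens: "tensor_assoc ((a \<otimes> b) \<otimes> c) = a \<otimes> b \<otimes> c"
  by (simp add: tensor_assoc_def tlift_tens[OF cbilinear_assoc2] tlift_tens[OF cbilinear_assoc1])

lemma tensor_unassoc_tens: "tensor_unassoc (a \<otimes> b \<otimes> c) = (a \<otimes> b) \<otimes> c"
  by (simp add: tensor_unassoc_def tlift_tens[OF cbilinear_unassoc2] tlift_tens[OF cbilinear_unassoc1])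

lemma clinear_tensor_assoc: "clinear tensor_assoc"
  by (simp add: tensor_assoc_def clinear_tlift[OF cbilinear_assoc2])

lemma clinear_tensor_unassoc: "clinear tensor_unassoc"
  by (simp add: tensor_unassoc_def clinear_tlift[OF cbilinear_unassoc2])

lemma tensor_induct3_right [case_names tens add]:
  assumes t: "\<And>a b c. P (a \<otimes> b \<otimes> c)" and a: "\<And>x y. P x \<Longrightarrow> P y \<Longrightarrow> P (x + y)"
  shows "P t"
proof (induction t rule: tensor_induct)
  case (tens a u)
  show ?case by (induction u rule: tensor_induct) (simp_all add: t a tens_simps)
qed (rule a)

lemma tensor_induct3_left [case_names tens add]:
  assumes t: "\<And>a b c. P ((a \<otimes> b) \<otimes> c)" and a: "\<And>x y. P x \<Longrightarrow> P y \<Longrightarrow> P (x + y)"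
  shows "P t"
proof (induction t rule: tensor_induct)
  case (tens u c)
  show ?case by (induction u rule: tensor_induct) (simp_all add: t a tens_simps)
qed (rule a)

lemma tensor_assoc_unassoc: "tensor_assoc (tensor_unassoc t) = t"
  by (induction t rule: tensor_induct3_right)
     (simp_all add: tensor_assoc_tens tensor_unassoc_tens
       clinear_add[OF clinear_tensor_assoc] clinear_add[OF clinear_tensor_unassoc])

lemma tensor_unassoc_assoc: "tensor_unassoc (tensor_assoc t) = t"
  by (induction t rule: tensor_induct3_left)
     (simp_all add: tensor_assoc_tens tensor_unassoc_tens
       clinear_add[OF clinear_tensor_assoc] clinear_add[OF clinear_tensor_unassoc])

lemma tensor_assoc_mult: "tensor_assoc (t * u) = tensor_assoc t * tensor_assoc u"
  for t u :: "('a::complex_algebra \<otimes> 'b::complex_algebra) \<otimes> 'c::complex_algebra"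
proof (induction t rule: tensor_induct3_left)
  case (tens a b c)
  show ?case
    by (induction u rule: tensor_induct3_left)
       (simp_all add: tensor_assoc_tens tens_mult_tens distrib_left clinear_add[OF clinear_tensor_assoc])
qed (simp add: distrib_right clinear_add[OF clinear_tensor_assoc])


section \<open>The multiplier algebra\<close>

text \<open>A multiplier \<open>m\<close> is the pair of maps \<open>x \<mapsto> m x\<close> and \<open>x \<mapsto> x m\<close>.\<close>

definition double_centralizer :: "('a::complex_algebra \<Rightarrow> 'a) \<times> ('a \<Rightarrow> 'a) \<Rightarrow> bool" where
  "double_centralizer p \<longleftrightarrow> clinear (fst p) \<and> clinear (snd p) \<and>
     (\<forall>a b. fst p (a * b) = fst p a * b \<and> snd p (a * b) = a * snd p b \<and> a * fst p b = snd p a * b)"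

typedef (overloaded) 'a multiplier =
  "{p :: ('a::complex_algebra \<Rightarrow> 'a) \<times> ('a \<Rightarrow> 'a). double_centralizer p}"
  by (rule exI[of _ "(id, id)"]) (auto simp: double_centralizer_def intro!: clinearI)

setup_lifting type_definition_multiplier

lift_definition mleft :: "'a::complex_algebra multiplier \<Rightarrow> 'a \<Rightarrow> 'a"  (infixr "\<triangleright>" 73) is fst .
lift_definition mright_aux :: "'a::complex_algebra multiplier \<Rightarrow> 'a \<Rightarrow> 'a" is snd .

definition mright :: "'a::complex_algebra \<Rightarrow> 'a multiplier \<Rightarrow> 'a"  (infixl "\<triangleleft>" 73) where
  "x \<triangleleft> m = mright_aux m x"

lemma clinear_mleft: "clinear (mleft m)"
  by transfer (auto simp: double_centralizer_def)

lemma clinear_mright: "clinear (\<lambda>x. x \<triangleleft> m)"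
  unfolding mright_def by transfer (auto simp: double_centralizer_def)

lemma mleft_mult: "m \<triangleright> (a * b) = (m \<triangleright> a) * b"
  by transfer (auto simp: double_centralizer_def)

lemma mright_mult: "(a * b) \<triangleleft> m = a * (b \<triangleleft> m)"
  unfolding mright_def by transfer (auto simp: double_centralizer_def)

lemma mult_mleft: "a * (m \<triangleright> b) = (a \<triangleleft> m) * b"
  unfolding mright_def by transfer (auto simp: double_centralizer_def)

lemma multiplier_eqI:
  assumes "\<And>x. m \<triangleright> x = n \<triangleright> x" and "\<And>x. x \<triangleleft> m = x \<triangleleft> n"
  shows "m = n"
  using assms unfolding mright_def by transfer (auto simp: prod_eq_iff)

lemma Abs_multiplier_apply:
  assumes "double_centralizer (f, g)"
  shows "Abs_multiplier (f, g) \<triangleright> x = f x" and "x \<triangleleft> Abs_multiplier (f, g) = g x"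
  using Abs_multiplier_inverse[of "(f, g)"] assms
  by (simp_all add: mleft.rep_eq mright_def mright_aux.rep_eq)

instantiation multiplier :: (complex_algebra) complex_algebra
begin
lift_definition zero_multiplier :: "'a multiplier" is "(\<lambda>_. 0, \<lambda>_. 0)"
  by (auto simp: double_centralizer_def intro!: clinearI)
lift_definition plus_multiplier :: "'a multiplier \<Rightarrow> 'a multiplier \<Rightarrow> 'a multiplier"
  is "\<lambda>p q. (\<lambda>x. fst p x + fst q x, \<lambda>x. snd p x + snd q x)"
  by (auto simp: double_centralizer_def clinear_add clinear_scale algebra_simps scaleC_add_right
      intro!: clinearI)
lift_definition uminus_multiplier :: "'a multiplier \<Rightarrow> 'a multiplier"
  is "\<lambda>p. (\<lambda>x. - fst p x, \<lambda>x. - snd p x)"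
  by (auto simp: double_centralizer_def clinear_add clinear_scale intro!: clinearI)
lift_definition minus_multiplier :: "'a multiplier \<Rightarrow> 'a multiplier \<Rightarrow> 'a multiplier"
  is "\<lambda>p q. (\<lambda>x. fst p x - fst q x, \<lambda>x. snd p x - snd q x)"
  by (auto simp: double_centralizer_def clinear_add clinear_scale algebra_simps
      cvec.scale_right_diff_distrib intro!: clinearI)
lift_definition scaleC_multiplier :: "complex \<Rightarrow> 'a multiplier \<Rightarrow> 'a multiplier"
  is "\<lambda>c p. (\<lambda>x. c *\<^sub>C fst p x, \<lambda>x. c *\<^sub>C snd p x)"
  by (auto simp: double_centralizer_def clinear_add clinear_scale scaleC_add_right scaleC_scaleC
      mult_scaleC_left mult_scaleC_right mult.commute intro!: clinearI)
lift_definition times_multiplier :: "'a multiplier \<Rightarrow> 'a multiplier \<Rightarrow> 'a multiplier"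
  is "\<lambda>p q. (\<lambda>x. fst p (fst q x), \<lambda>x. snd q (snd p x))"
  by (auto simp: double_centralizer_def clinear_add clinear_scale intro!: clinearI)
instance
  by standard (transfer; simp add: double_centralizer_def clinear_add clinear_scale fun_eq_iff
      algebra_simps scaleC_add_right scaleC_add_left scaleC_scaleC scaleC_one)+
end

instantiation multiplier :: (complex_algebra) monoid_mult
begin
lift_definition one_multiplier :: "'a multiplier" is "(\<lambda>x. x, \<lambda>x. x)"
  by (auto simp: double_centralizer_def intro!: clinearI)
instance
  by standard (transfer; simp)+
end

lemma mleft_times [simp]: "(m * n) \<triangleright> x = m \<triangleright> n \<triangleright> x"
  by transfer simp

lemma mright_times [simp]: "x \<triangleleft> (m * n) = x \<triangleleft> m \<triangleleft> n"
  unfolding mright_def by transfer simp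

lemma mleft_one [simp]: "1 \<triangleright> x = x"
  by transfer simp

lemma mright_one [simp]: "x \<triangleleft> 1 = x"
  unfolding mright_def by transfer simp

lift_definition mul_of :: "'a::complex_algebra \<Rightarrow> 'a multiplier"
  is "\<lambda>a. (\<lambda>x. a * x, \<lambda>x. x * a)"
  by (auto simp: double_centralizer_def distrib_left distrib_right mult_scaleC_left
      mult_scaleC_right mult.assoc intro!: clinearI)

lemma mleft_mul_of [simp]: "mul_of a \<triangleright> x = a * x"
  by transfer simp

lemma mright_mul_of [simp]: "x \<triangleleft> mul_of a = x * a"
  unfolding mright_def by transfer simp

text \<open>The element of \<open>A\<close> that a multiplier in the image of \<open>A\<close> stands for; it is unique because
  the product of \<open>A\<close> is non-degenerate.\<close>

definition elt_of :: "'a::complex_algebra multiplier \<Rightarrow> 'a" where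
  "elt_of m = inv mul_of m"

definition mtens ::
  "'a::complex_algebra multiplier \<Rightarrow> 'b::complex_algebra multiplier \<Rightarrow> ('a \<otimes> 'b) multiplier"
  (infixr "\<otimes>\<^sub>M" 72) where
  "m \<otimes>\<^sub>M n = Abs_multiplier
     (map_tensor (\<lambda>x. m \<triangleright> x) (\<lambda>y. n \<triangleright> y), map_tensor (\<lambda>x. x \<triangleleft> m) (\<lambda>y. y \<triangleleft> n))"

lemma double_centralizer_mtens:
  "double_centralizer
     (map_tensor (\<lambda>x. m \<triangleright> x) (\<lambda>y. n \<triangleright> y), map_tensor (\<lambda>x. x \<triangleleft> m) (\<lambda>y. y \<triangleleft> n))"
proof -
  note L = clinear_map_tensor[OF clinear_mleft[of m] clinear_mleft[of n]]
  note R = clinear_map_tensor[OF clinear_mright[of m] clinear_mright[of n]]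
  note e = map_tensor_tens[OF clinear_mleft[of m] clinear_mleft[of n]]
    map_tensor_tens[OF clinear_mright[of m] clinear_mright[of n]]
  have 1: "map_tensor (mleft m) (mleft n) ((a \<otimes> b) * u) = map_tensor (mleft m) (mleft n) (a \<otimes> b) * u"
    "map_tensor (\<lambda>x. x \<triangleleft> m) (\<lambda>y. y \<triangleleft> n) ((a \<otimes> b) * u) = (a \<otimes> b) * map_tensor (\<lambda>x. x \<triangleleft> m) (\<lambda>y. y \<triangleleft> n) u"
    "(a \<otimes> b) * map_tensor (mleft m) (mleft n) u = map_tensor (\<lambda>x. x \<triangleleft> m) (\<lambda>y. y \<triangleleft> n) (a \<otimes> b) * u" for a b u
    by (induction u rule: tensor_induct)
       (simp_all add: tens_mult_tens e mleft_mult mright_mult mult_mleft distrib_left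
          clinear_add[OF L] clinear_add[OF R])
  have "map_tensor (mleft m) (mleft n) (t * u) = map_tensor (mleft m) (mleft n) t * u"
    "map_tensor (\<lambda>x. x \<triangleleft> m) (\<lambda>y. y \<triangleleft> n) (t * u) = t * map_tensor (\<lambda>x. x \<triangleleft> m) (\<lambda>y. y \<triangleleft> n) u"
    "t * map_tensor (mleft m) (mleft n) u = map_tensor (\<lambda>x. x \<triangleleft> m) (\<lambda>y. y \<triangleleft> n) t * u" for t u
    by (induction t rule: tensor_induct)
       (simp_all add: 1 distrib_right clinear_add[OF L] clinear_add[OF R])
  then show ?thesis
    unfolding double_centralizer_def using L R by simp
qed

lemma mleft_mtens: "(m \<otimes>\<^sub>M n) \<triangleright> t = map_tensor (mleft m) (mleft n) t"
  unfolding mtens_def by (rule Abs_multiplier_apply(1)[OF double_centralizer_mtens])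

lemma mright_mtens: "t \<triangleleft> (m \<otimes>\<^sub>M n) = map_tensor (\<lambda>x. x \<triangleleft> m) (\<lambda>y. y \<triangleleft> n) t"
  unfolding mtens_def by (rule Abs_multiplier_apply(2)[OF double_centralizer_mtens])

lemma mleft_mtens_tens [simp]: "(m \<otimes>\<^sub>M n) \<triangleright> (a \<otimes> b) = (m \<triangleright> a) \<otimes> (n \<triangleright> b)"
  by (simp add: mleft_mtens map_tensor_tens clinear_mleft)

lemma mright_mtens_tens [simp]: "(a \<otimes> b) \<triangleleft> (m \<otimes>\<^sub>M n) = (a \<triangleleft> m) \<otimes> (b \<triangleleft> n)"
  by (simp add: mright_mtens map_tensor_tens clinear_mright)

lemma multiplier_tensor_eqI:
  assumes "\<And>a b. m \<triangleright> (a \<otimes> b) = n \<triangleright> (a \<otimes> b)" and "\<And>a b. (a \<otimes> b) \<triangleleft> m = (a \<otimes> b) \<triangleleft> n"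
  shows "m = n"
  by (rule multiplier_eqI)
     (rule tensor_ext[OF clinear_mleft clinear_mleft assms(1)]
       tensor_ext[OF clinear_mright clinear_mright assms(2)])+

lemma mtens_mul_of: "mul_of a \<otimes>\<^sub>M mul_of b = mul_of (a \<otimes> b)"
  by (rule multiplier_tensor_eqI) (simp_all add: tens_mult_tens)

lemma mtens_one: "1 \<otimes>\<^sub>M 1 = 1"
  by (rule multiplier_tensor_eqI) simp_all

lemma mtens_mult: "(m \<otimes>\<^sub>M n) * (m' \<otimes>\<^sub>M n') = (m * m') \<otimes>\<^sub>M (n * n')"
  by (rule multiplier_tensor_eqI) simp_all

definition algebra_hom :: "('a::complex_algebra \<Rightarrow> 'b::complex_algebra) \<Rightarrow> bool" where
  "algebra_hom f \<longleftrightarrow> clinear f \<and> (\<forall>x y. f (x * y) = f x * f y)"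

text \<open>Transport of multipliers along an algebra isomorphism.\<close>

definition mtransport ::
  "('a::complex_algebra \<Rightarrow> 'b::complex_algebra) \<Rightarrow> 'a multiplier \<Rightarrow> 'b multiplier" where
  "mtransport f m = Abs_multiplier (\<lambda>x. f (m \<triangleright> inv f x), \<lambda>x. f (inv f x \<triangleleft> m))"

lemma mtransport_apply:
  assumes "algebra_hom f" "bij f"
  shows "mtransport f m \<triangleright> f x = f (m \<triangleright> x)" and "f x \<triangleleft> mtransport f m = f (x \<triangleleft> m)"
proof -
  have f: "clinear f" "f (a * b) = f a * f b" "inv f (f a) = a" "f (inv f y) = y" for a b y
    using assms by (auto simp: algebra_hom_def bij_is_inj bij_is_surj surj_f_inv_f)
  have i: "inv f (y + z) = inv f y + inv f z" "inv f (c *\<^sub>C y) = c *\<^sub>C inv f y"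
    "inv f (y * z) = inv f y * inv f z" for y z c
    using f(3)[of "inv f y + inv f z"] f(3)[of "c *\<^sub>C inv f y"] f(3)[of "inv f y * inv f z"]
    by (simp_all add: clinear_add[OF f(1)] clinear_scale[OF f(1)] f(2,4))
  have dc: "double_centralizer (\<lambda>x. f (m \<triangleright> inv f x), \<lambda>x. f (inv f x \<triangleleft> m))"
  proof -
    have "y * f (m \<triangleright> inv f z) = f (inv f y \<triangleleft> m) * z" for y z
      by (metis f(2,4) mult_mleft)
    moreover have "f (m \<triangleright> inv f (y * z)) = f (m \<triangleright> inv f y) * z"
      "f (inv f (y * z) \<triangleleft> m) = y * f (inv f z \<triangleleft> m)" for y z
      by (simp_all add: i mleft_mult mright_mult f(2,4))
    ultimately show ?thesis
      by (auto simp: double_centralizer_def i clinear_add[OF f(1)] clinear_scale[OF f(1)]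
          clinear_add[OF clinear_mleft] clinear_scale[OF clinear_mleft]
          clinear_add[OF clinear_mright] clinear_scale[OF clinear_mright] intro!: clinearI)
  qed
  show "mtransport f m \<triangleright> f x = f (m \<triangleright> x)"
    unfolding mtransport_def by (simp add: Abs_multiplier_apply[OF dc] f(3))
  show "f x \<triangleleft> mtransport f m = f (x \<triangleleft> m)"
    unfolding mtransport_def by (simp add: Abs_multiplier_apply[OF dc] f(3))
qed

definition leg12 :: "('a::complex_algebra \<otimes> 'b::complex_algebra) multiplier
    \<Rightarrow> ('a \<otimes> 'b \<otimes> 'c::complex_algebra) multiplier" where
  "leg12 m = mtransport tensor_assoc (m \<otimes>\<^sub>M 1)"

definition leg23 :: "('b::complex_algebra \<otimes> 'c::complex_algebra) multiplier
    \<Rightarrow> ('a::complex_algebra \<otimes> 'b \<otimes> 'c) multiplier" where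
  "leg23 m = 1 \<otimes>\<^sub>M m"

definition leg13 :: "('a::complex_algebra \<otimes> 'c::complex_algebra) multiplier
    \<Rightarrow> ('a \<otimes> 'b::complex_algebra \<otimes> 'c) multiplier" where
  "leg13 m = mtransport (map_tensor (\<lambda>x. x) tensor_swap) (leg12 m)"

lemma tensor_assoc_iso: "algebra_hom tensor_assoc" "bij tensor_assoc"
  by (simp_all add: algebra_hom_def clinear_tensor_assoc tensor_assoc_mult)
     (metis bijI' tensor_assoc_unassoc tensor_unassoc_assoc)

lemma clinear_ident: "clinear (\<lambda>x. x)"
  by (rule clinearI) simp_all

lemma swap23_iso:
  "algebra_hom (map_tensor (\<lambda>x::'a::complex_algebra. x)
     (tensor_swap :: 'b::complex_algebra \<otimes> 'c::complex_algebra \<Rightarrow> _))"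
  "bij (map_tensor (\<lambda>x::'a::complex_algebra. x)
     (tensor_swap :: 'b::complex_algebra \<otimes> 'c::complex_algebra \<Rightarrow> _))"
proof -
  note e = map_tensor_tens[OF clinear_ident clinear_tensor_swap] tensor_swap_tens
  note l = clinear_map_tensor[OF clinear_ident clinear_tensor_swap]
  let ?s = "map_tensor (\<lambda>x::'a. x) (tensor_swap :: 'b \<otimes> 'c \<Rightarrow> _)"
  let ?s' = "map_tensor (\<lambda>x::'a. x) (tensor_swap :: 'c \<otimes> 'b \<Rightarrow> _)"
  have "?s' (?s t) = t" for t
    by (induction t rule: tensor_induct3_right) (simp_all add: e clinear_add[OF l])
  moreover have "?s (?s' t) = t" for t
    by (induction t rule: tensor_induct3_right) (simp_all add: e clinear_add[OF l])
  ultimately show "bij ?s" by (metis bijI')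
  have "?s (t * u) = ?s t * ?s u" for t u
  proof (induction t rule: tensor_induct3_right)
    case (tens a b c)
    show ?case
      by (induction u rule: tensor_induct3_right)
         (simp_all add: e tens_mult_tens distrib_left clinear_add[OF l])
  qed (simp add: distrib_right clinear_add[OF l])
  then show "algebra_hom ?s" by (simp add: algebra_hom_def l)
qed

lemma multiplier_tensor3_eqI:
  assumes "\<And>a b c. m \<triangleright> (a \<otimes> b \<otimes> c) = n \<triangleright> (a \<otimes> b \<otimes> c)"
    and "\<And>a b c. (a \<otimes> b \<otimes> c) \<triangleleft> m = (a \<otimes> b \<otimes> c) \<triangleleft> n"
  shows "m = n"
proof (rule multiplier_eqI)
  fix t
  show "m \<triangleright> t = n \<triangleright> t"
    by (induction t rule: tensor_induct3_right) (simp_all add: assms clinear_add[OF clinear_mleft])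
  show "t \<triangleleft> m = t \<triangleleft> n"
    by (induction t rule: tensor_induct3_right) (simp_all add: assms clinear_add[OF clinear_mright])
qed

lemma mtransport_assoc_mtens: "mtransport tensor_assoc ((m \<otimes>\<^sub>M n) \<otimes>\<^sub>M k) = m \<otimes>\<^sub>M n \<otimes>\<^sub>M k"
proof (rule multiplier_tensor3_eqI)
  fix a b c
  show "mtransport tensor_assoc ((m \<otimes>\<^sub>M n) \<otimes>\<^sub>M k) \<triangleright> (a \<otimes> b \<otimes> c) = (m \<otimes>\<^sub>M n \<otimes>\<^sub>M k) \<triangleright> (a \<otimes> b \<otimes> c)"
    using mtransport_apply(1)[OF tensor_assoc_iso, of "(m \<otimes>\<^sub>M n) \<otimes>\<^sub>M k" "(a \<otimes> b) \<otimes> c"]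
    by (simp add: tensor_assoc_tens)
  show "(a \<otimes> b \<otimes> c) \<triangleleft> mtransport tensor_assoc ((m \<otimes>\<^sub>M n) \<otimes>\<^sub>M k) = (a \<otimes> b \<otimes> c) \<triangleleft> (m \<otimes>\<^sub>M n \<otimes>\<^sub>M k)"
    using mtransport_apply(2)[OF tensor_assoc_iso, of "(a \<otimes> b) \<otimes> c" "(m \<otimes>\<^sub>M n) \<otimes>\<^sub>M k"]
    by (simp add: tensor_assoc_tens)
qed

lemma leg12_mtens: "leg12 (m \<otimes>\<^sub>M n) = m \<otimes>\<^sub>M n \<otimes>\<^sub>M 1"
  by (simp add: leg12_def mtransport_assoc_mtens)

lemma leg13_mtens: "leg13 (m \<otimes>\<^sub>M n) = m \<otimes>\<^sub>M 1 \<otimes>\<^sub>M n"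
proof (rule multiplier_tensor3_eqI)
  note e = map_tensor_tens[OF clinear_ident clinear_tensor_swap] tensor_swap_tens
  fix a b c
  show "leg13 (m \<otimes>\<^sub>M n) \<triangleright> (a \<otimes> b \<otimes> c) = (m \<otimes>\<^sub>M 1 \<otimes>\<^sub>M n) \<triangleright> (a \<otimes> b \<otimes> c)"
    using mtransport_apply(1)[OF swap23_iso, of "leg12 (m \<otimes>\<^sub>M n)" "a \<otimes> c \<otimes> b"]
    by (simp add: leg13_def leg12_mtens e)
  show "(a \<otimes> b \<otimes> c) \<triangleleft> leg13 (m \<otimes>\<^sub>M n) = (a \<otimes> b \<otimes> c) \<triangleleft> (m \<otimes>\<^sub>M 1 \<otimes>\<^sub>M n)"
    using mtransport_apply(2)[OF swap23_iso, of "a \<otimes> c \<otimes> b" "leg12 (m \<otimes>\<^sub>M n)"]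
    by (simp add: leg13_def leg12_mtens e)
qed

text \<open>The unique extension of a homomorphism \<open>f\<close> to the multiplier algebra with value \<open>e\<close> at \<open>1\<close>.\<close>

definition hom_extension ::
  "('a::complex_algebra \<Rightarrow> 'b::complex_algebra multiplier) \<Rightarrow> 'b multiplier
    \<Rightarrow> 'a multiplier \<Rightarrow> 'b multiplier" where
  "hom_extension f e = (THE F. algebra_hom F \<and> (\<forall>x. F (mul_of x) = f x) \<and> F 1 = e)"


section \<open>Weak multiplier Hopf algebras\<close>

definition T1 :: "('a::complex_algebra \<Rightarrow> ('a \<otimes> 'a) multiplier) \<Rightarrow> 'a \<otimes> 'a \<Rightarrow> 'a \<otimes> 'a" where
  "T1 \<Delta> = tlift (\<lambda>a b. elt_of (\<Delta> a * (1 \<otimes>\<^sub>M mul_of b)))"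

definition T2 :: "('a::complex_algebra \<Rightarrow> ('a \<otimes> 'a) multiplier) \<Rightarrow> 'a \<otimes> 'a \<Rightarrow> 'a \<otimes> 'a" where
  "T2 \<Delta> = tlift (\<lambda>a b. elt_of ((mul_of a \<otimes>\<^sub>M 1) * \<Delta> b))"

definition coproduct_id ::
  "('a::complex_algebra \<Rightarrow> ('a \<otimes> 'a) multiplier) \<Rightarrow> 'a \<otimes> 'a \<Rightarrow> ('a \<otimes> 'a \<otimes> 'a) multiplier" where
  "coproduct_id \<Delta> = tlift (\<lambda>a b. mtransport tensor_assoc (\<Delta> a \<otimes>\<^sub>M mul_of b))"

definition id_coproduct ::
  "('a::complex_algebra \<Rightarrow> ('a \<otimes> 'a) multiplier) \<Rightarrow> 'a \<otimes> 'a \<Rightarrow> ('a \<otimes> 'a \<otimes> 'a) multiplier" where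
  "id_coproduct \<Delta> = tlift (\<lambda>a b. mul_of a \<otimes>\<^sub>M \<Delta> b)"

definition slice_left :: "('a::complex_vector \<Rightarrow> complex) \<Rightarrow> 'a \<otimes> 'b::complex_vector \<Rightarrow> 'b" where
  "slice_left \<omega> = tlift (\<lambda>a b. \<omega> a *\<^sub>C b)"

definition slice_right :: "('b::complex_vector \<Rightarrow> complex) \<Rightarrow> 'a::complex_vector \<otimes> 'b \<Rightarrow> 'a" where
  "slice_right \<omega> = tlift (\<lambda>a b. \<omega> b *\<^sub>C a)"

text \<open>The smallest subspace \<open>V\<close> with \<open>X \<subseteq> V \<otimes> A\<close>, respectively \<open>W\<close> with \<open>X \<subseteq> A \<otimes> W\<close>.\<close>

definition left_leg :: "('a::complex_vector \<otimes> 'b::complex_vector) set \<Rightarrow> 'a set" where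
  "left_leg X = \<Inter> {V. cvec.subspace V \<and> X \<subseteq> cvec.span {v \<otimes> b | v b. v \<in> V}}"

definition right_leg :: "('a::complex_vector \<otimes> 'b::complex_vector) set \<Rightarrow> 'b set" where
  "right_leg X = \<Inter> {W. cvec.subspace W \<and> X \<subseteq> cvec.span {a \<otimes> w | a w. w \<in> W}}"

text \<open>\<open>G \<otimes> id\<close> and \<open>id \<otimes> G\<close> on \<open>A \<otimes> A \<otimes> A\<close>; the triple tensor product is bracketed to the right.\<close>

definition map_first2 ::
  "('a::complex_vector \<otimes> 'a \<Rightarrow> 'a \<otimes> 'a) \<Rightarrow> 'a \<otimes> 'a \<otimes> 'a \<Rightarrow> 'a \<otimes> 'a \<otimes> 'a" where
  "map_first2 G t = tensor_assoc (map_tensor G (\<lambda>x. x) (tensor_unassoc t))"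

definition map_last2 ::
  "('a::complex_vector \<otimes> 'a \<Rightarrow> 'a \<otimes> 'a) \<Rightarrow> 'a \<otimes> 'a \<otimes> 'a \<Rightarrow> 'a \<otimes> 'a \<otimes> 'a" where
  "map_last2 G = map_tensor (\<lambda>x. x) G"

text \<open>\<open>\<epsilon>\<close>, \<open>E\<close>, \<open>G1\<close> and \<open>G2\<close> are parameters of the locale, but each of them is uniquely determined by
  the coproduct, so quantifying over them amounts to asserting that they exist.\<close>

locale weak_multiplier_hopf_algebra =
  fixes \<Delta> :: "'a::complex_algebra \<Rightarrow> ('a \<otimes> 'a) multiplier"
    and \<epsilon> :: "'a \<Rightarrow> complex"
    and E :: "('a \<otimes> 'a) multiplier"
    and G1 G2 :: "'a \<otimes> 'a \<Rightarrow> 'a \<otimes> 'a"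
  assumes nondegenerate:
      "(\<And>b. a * b = 0) \<Longrightarrow> a = (0::'a)"
      "(\<And>b. b * a = 0) \<Longrightarrow> a = (0::'a)"
    and idempotent_algebra: "cvec.span {a * b | a b. True} = (UNIV :: 'a set)"
    and coproduct_hom: "algebra_hom \<Delta>"
    and coproduct_range:
      "\<Delta> a * (1 \<otimes>\<^sub>M mul_of b) \<in> range mul_of"
      "(mul_of a \<otimes>\<^sub>M 1) * \<Delta> b \<in> range mul_of"
    and coassociative:
      "(mul_of a \<otimes>\<^sub>M 1 \<otimes>\<^sub>M 1) * coproduct_id \<Delta> (T1 \<Delta> (b \<otimes> c))
        = id_coproduct \<Delta> (T2 \<Delta> (a \<otimes> b)) * (1 \<otimes>\<^sub>M 1 \<otimes>\<^sub>M mul_of c)"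
    and full:
      "left_leg {T1 \<Delta> (a \<otimes> b) | a b. True} = UNIV"
      "right_leg {T2 \<Delta> (a \<otimes> b) | a b. True} = UNIV"
    and counit_linear: "clinear \<epsilon>"
    and counit:
      "slice_left \<epsilon> (T1 \<Delta> (a \<otimes> b)) = a * b"
      "slice_right \<epsilon> (T2 \<Delta> (c \<otimes> a)) = c * a"
    and E_idempotent: "E * E = E"
    and E_range:
      "range (T1 \<Delta>) = range (\<lambda>t. E \<triangleright> t)"
      "range (T2 \<Delta>) = range (\<lambda>t. t \<triangleleft> E)"
    and id_coproduct_E:
      "hom_extension (id_coproduct \<Delta>) (1 \<otimes>\<^sub>M E) E = leg12 E * leg23 E"
      "hom_extension (id_coproduct \<Delta>) (1 \<otimes>\<^sub>M E) E = leg23 E * leg12 E"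
    and G_linear: "clinear G1" "clinear G2"
    and G1:
      "mul_of (map_first2 G1 (elt_of (leg13 (\<Delta> a) * (1 \<otimes>\<^sub>M mul_of b \<otimes>\<^sub>M mul_of c))))
        = leg13 (\<Delta> a) * leg23 E * (1 \<otimes>\<^sub>M mul_of b \<otimes>\<^sub>M mul_of c)"
    and G2:
      "mul_of (map_last2 G2 (elt_of ((mul_of a \<otimes>\<^sub>M mul_of b \<otimes>\<^sub>M 1) * leg13 (\<Delta> c))))
        = (mul_of a \<otimes>\<^sub>M mul_of b \<otimes>\<^sub>M 1) * leg12 E * leg13 (\<Delta> c)"
    and kernels:
      "{t. T1 \<Delta> t = 0} = range (\<lambda>t. t - G1 t)"
      "{t. T2 \<Delta> t = 0} = range (\<lambda>t. t - G2 t)"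

text \<open>The Sweedler formulas characterising the antipode, with their coverings.  The maps \<open>R1\<close> and
  \<open>R2\<close> are \<open>R1 (a \<otimes> b) = \<Sum> a\<^sub>1 \<otimes> S(a\<^sub>2) b\<close> and \<open>R2 (a \<otimes> b) = \<Sum> a S(b\<^sub>1) \<otimes> b\<^sub>2\<close>; these lie in
  \<open>A \<otimes> A\<close>, and are determined by covering the remaining leg:
  \<open>(c \<otimes> 1) R1 (a \<otimes> b) = \<Sum> c a\<^sub>1 \<otimes> S(a\<^sub>2) b\<close> and \<open>R2 (a \<otimes> b) (1 \<otimes> c) = \<Sum> a S(b\<^sub>1) \<otimes> b\<^sub>2 c\<close>.
  Then \<open>T1 (R1 (a \<otimes> b)) = \<Sum> a\<^sub>1 \<otimes> a\<^sub>2 S(a\<^sub>3) b\<close>, \<open>R1 (T1 (a \<otimes> b)) = \<Sum> a\<^sub>1 \<otimes> S(a\<^sub>2) a\<^sub>3 b\<close>,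
  and similarly for \<open>T2\<close> and \<open>R2\<close>.\<close>

definition is_antipode ::
  "('a::complex_algebra \<Rightarrow> ('a \<otimes> 'a) multiplier) \<Rightarrow> ('a \<otimes> 'a) multiplier
    \<Rightarrow> ('a \<otimes> 'a \<Rightarrow> 'a \<otimes> 'a) \<Rightarrow> ('a \<otimes> 'a \<Rightarrow> 'a \<otimes> 'a) \<Rightarrow> ('a \<Rightarrow> 'a multiplier) \<Rightarrow> bool" where
  "is_antipode \<Delta> E G1 G2 S \<longleftrightarrow>
     clinear S \<and> (\<forall>a b. S (a * b) = S b * S a) \<and>
     cvec.span {S a \<triangleright> b | a b. True} = UNIV \<and> cvec.span {b \<triangleleft> S a | a b. True} = UNIV \<and>
     (\<exists>R1 R2. clinear R1 \<and> clinear R2 \<and>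
        (\<forall>a b c. (mul_of c \<otimes>\<^sub>M 1) \<triangleright> R1 (a \<otimes> b) = tlift (\<lambda>p q. p \<otimes> (S q \<triangleright> b)) (T2 \<Delta> (c \<otimes> a))) \<and>
        (\<forall>a b c. R2 (a \<otimes> b) \<triangleleft> (1 \<otimes>\<^sub>M mul_of c) = tlift (\<lambda>p q. (a \<triangleleft> S p) \<otimes> q) (T1 \<Delta> (b \<otimes> c))) \<and>
        (\<forall>a b. E \<triangleright> (a \<otimes> b) = T1 \<Delta> (R1 (a \<otimes> b))) \<and>
        (\<forall>a b. (a \<otimes> b) \<triangleleft> E = T2 \<Delta> (R2 (a \<otimes> b))) \<and>
        (\<forall>a b. G1 (a \<otimes> b) = R1 (T1 \<Delta> (a \<otimes> b))) \<and>
        (\<forall>a b. G2 (a \<otimes> b) = R2 (T2 \<Delta> (a \<otimes> b))) \<and>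
        (\<forall>a b. tlift (\<lambda>p q. S p \<triangleright> q) (T1 \<Delta> (R1 (a \<otimes> b))) = S a \<triangleright> b))"

locale regular_weak_multiplier_hopf_algebra = weak_multiplier_hopf_algebra \<Delta> \<epsilon> E G1 G2
  for \<Delta> :: "'a::complex_algebra \<Rightarrow> ('a \<otimes> 'a) multiplier"
    and \<epsilon> E G1 G2 +
  fixes S :: "'a \<Rightarrow> 'a multiplier"
  assumes antipode: "is_antipode \<Delta> E G1 G2 S"
    and regular: "bij_betw S UNIV (range mul_of)"


section \<open>Integrals and cointegrals\<close>

text \<open>The multiplier \<open>y = \<Sum> a\<^sub>1 S(a\<^sub>2)\<close>, given by \<open>c y = \<Sum> c a\<^sub>1 S(a\<^sub>2)\<close>.\<close>

definition eps_t ::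
  "('a::complex_algebra \<Rightarrow> ('a \<otimes> 'a) multiplier) \<Rightarrow> ('a \<Rightarrow> 'a multiplier) \<Rightarrow> 'a \<Rightarrow> 'a multiplier" where
  "eps_t \<Delta> S a = (THE y. \<forall>c. c \<triangleleft> y = tlift (\<lambda>p q. p \<triangleleft> S q) (T2 \<Delta> (c \<otimes> a)))"

definition target_algebra ::
  "('a::complex_algebra \<Rightarrow> ('a \<otimes> 'a) multiplier) \<Rightarrow> ('a \<otimes> 'a) multiplier \<Rightarrow> 'a multiplier set" where
  "target_algebra \<Delta> E = {x. hom_extension \<Delta> E x = (x \<otimes>\<^sub>M 1) * E}"

text \<open>In \<open>left_integral\<close>, \<open>y\<close> is the multiplier \<open>(id \<otimes> \<phi>) \<Delta>(a)\<close>.  By regularity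
  \<open>\<Delta>(a)(b \<otimes> 1)\<close> and \<open>(b \<otimes> 1)\<Delta>(a)\<close> lie in \<open>A \<otimes> A\<close>.\<close>

definition left_integral ::
  "('a::complex_algebra \<Rightarrow> ('a \<otimes> 'a) multiplier) \<Rightarrow> ('a \<otimes> 'a) multiplier \<Rightarrow> ('a \<Rightarrow> complex) \<Rightarrow> bool" where
  "left_integral \<Delta> E \<phi> \<longleftrightarrow> clinear \<phi> \<and> \<phi> \<noteq> (\<lambda>_. 0) \<and>
     (\<forall>a. \<exists>y \<in> target_algebra \<Delta> E. \<forall>b.
        y \<triangleright> b = slice_right \<phi> (elt_of (\<Delta> a * (mul_of b \<otimes>\<^sub>M 1))) \<and>
        b \<triangleleft> y = slice_right \<phi> (elt_of ((mul_of b \<otimes>\<^sub>M 1) * \<Delta> a)))"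

definition faithful_left_integrals ::
  "('a::complex_algebra \<Rightarrow> ('a \<otimes> 'a) multiplier) \<Rightarrow> ('a \<otimes> 'a) multiplier \<Rightarrow> bool" where
  "faithful_left_integrals \<Delta> E \<longleftrightarrow>
     (\<forall>x. (\<forall>\<phi> a. left_integral \<Delta> E \<phi> \<longrightarrow> \<phi> (x * a) = 0) \<longrightarrow> x = 0) \<and>
     (\<forall>x. (\<forall>\<phi> a. left_integral \<Delta> E \<phi> \<longrightarrow> \<phi> (a * x) = 0) \<longrightarrow> x = 0)"

definition compact_type ::
  "('a::complex_algebra \<Rightarrow> ('a \<otimes> 'a) multiplier) \<Rightarrow> ('a \<Rightarrow> complex) \<Rightarrow> ('a \<otimes> 'a) multiplier
    \<Rightarrow> ('a \<otimes> 'a \<Rightarrow> 'a \<otimes> 'a) \<Rightarrow> ('a \<otimes> 'a \<Rightarrow> 'a \<otimes> 'a) \<Rightarrow> ('a \<Rightarrow> 'a multiplier) \<Rightarrow> bool" where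
  "compact_type \<Delta> \<epsilon> E G1 G2 S \<longleftrightarrow>
     regular_weak_multiplier_hopf_algebra \<Delta> \<epsilon> E G1 G2 S \<and>
     faithful_left_integrals \<Delta> E \<and>
     (\<exists>e::'a. \<forall>a. e * a = a \<and> a * e = a)"

definition left_cointegral ::
  "('a::complex_algebra \<Rightarrow> ('a \<otimes> 'a) multiplier) \<Rightarrow> ('a \<Rightarrow> 'a multiplier) \<Rightarrow> 'a multiplier \<Rightarrow> bool" where
  "left_cointegral \<Delta> S h \<longleftrightarrow> h \<noteq> 0 \<and> (\<forall>a. mul_of a * h = eps_t \<Delta> S a * h)"

definition cointegral_space ::
  "('a::complex_algebra \<Rightarrow> ('a \<otimes> 'a) multiplier) \<Rightarrow> ('a \<Rightarrow> 'a multiplier) \<Rightarrow> 'a set" where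
  "cointegral_space \<Delta> S = {h. h = 0 \<or> left_cointegral \<Delta> S (mul_of h)}"

definition discrete_type ::
  "('a::complex_algebra \<Rightarrow> ('a \<otimes> 'a) multiplier) \<Rightarrow> ('a \<Rightarrow> 'a multiplier) \<Rightarrow> bool" where
  "discrete_type \<Delta> S \<longleftrightarrow>
     left_leg {T1 \<Delta> (h \<otimes> a) | h a. h \<in> cointegral_space \<Delta> S} = UNIV \<and>
     right_leg {T2 \<Delta> (a \<otimes> h) | a h. h \<in> cointegral_space \<Delta> S} = UNIV"

end

theory Submission
  imports Defs
begin

text \<open>
  Since \<open>A\<close> has an identity \<open>e\<close>, every multiplier of a tensor power of \<open>A\<close> is an element of it.  So
  \<open>\<Delta>\<close> takes values in the algebraic tensor product \<open>A \<otimes> A\<close> and \<open>E = \<Delta>(e)\<close> is a finite sum of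
  elementary tensors.  An element \<open>y\<close> of \<open>A\<^sub>t\<close> satisfies \<open>\<Delta>(y) = (y \<otimes> 1) E\<close>, and applying the
  counit to the first leg shows that \<open>y\<close> is a slice of \<open>E\<close>.  Hence \<open>A\<^sub>t\<close> is finite-dimensional
  (\<open>target_elements_in_finite_span\<close>).

  A left cointegral \<open>h\<close> satisfies \<open>(1 \<otimes> a) \<Delta>(h) = (S(a) \<otimes> 1) \<Delta>(h)\<close> (\<open>cop_cointegral\<close>).  In
  Sweedler notation, \<open>(1 \<otimes> a) \<Delta>(h) = (1 \<otimes> a) E \<Delta>(h) = \<Sum> (S(a\<^sub>1) \<otimes> 1) \<Delta>(a\<^sub>2 h)\<close>, which equals
  \<open>\<Sum> (S(a\<^sub>1) \<epsilon>\<^sub>t(a\<^sub>2) \<otimes> 1) \<Delta>(h)\<close> because \<open>a\<^sub>2 h = \<epsilon>\<^sub>t(a\<^sub>2) h\<close> and \<open>\<epsilon>\<^sub>t(a\<^sub>2)\<close> lies in \<open>A\<^sub>t\<close>; and \<open>\<Sum> S(a\<^sub>1) \<epsilon>\<^sub>t(a\<^sub>2) = S(a)\<close>.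

  For a left integral \<open>\<phi>\<close> and a cointegral \<open>h\<close> let \<open>y = (id \<otimes> \<phi>) \<Delta>(h)\<close>.  Slicing the formula
  above gives \<open>S(a) y = (id \<otimes> \<phi>(a \<cdot>)) \<Delta>(h)\<close>.  The right-hand side stays, for varying \<open>a\<close>, in
  the left leg of the single tensor \<open>\<Delta>(h)\<close>; as \<open>S\<close> is surjective, \<open>A y\<close> is finite-dimensional
  (\<open>left_ideal_of_slice_in_finite_span\<close>).  All these \<open>y\<close> lie in \<open>A\<^sub>t\<close>, so finitely many of them
  span the rest, and there is one finite-dimensional space \<open>V\<close> that contains all the left ideals
  \<open>A y\<close>.

  Finally \<open>V = A\<close>.  Let \<open>\<omega>\<close> be a functional that vanishes on \<open>V\<close>.  Then
  \<open>\<phi>(a \<cdot> (\<omega> \<otimes> id) \<Delta>(h)) = \<omega>(S(a) y) = 0\<close> for all \<open>\<phi>\<close> and \<open>a\<close>, so \<open>(\<omega> \<otimes> id) \<Delta>(h) = 0\<close> because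
  the integrals are faithful.  This being so for all \<open>\<omega>\<close>, the tensor \<open>\<Delta>(h)\<close> lies in \<open>V \<otimes> A\<close>
  (\<open>tensor_in_subspace_tensor\<close>).  Since the left leg of \<open>\<Delta>(H)\<close> is \<open>A\<close>, it follows that \<open>V = A\<close>.
\<close>

section \<open>Slices of tensors\<close>

lemma clinear_compose: "clinear f \<Longrightarrow> clinear g \<Longrightarrow> clinear (\<lambda>x. f (g x))"
  by (rule clinearI) (simp_all add: clinear_add clinear_scale)

lemma clinear_mult_left: "clinear (\<lambda>x. (a :: 'a::complex_algebra) * x)"
  by (rule clinearI) (simp_all add: distrib_left mult_scaleC_right)

lemma cbilinear_slice_left: "clinear \<omega> \<Longrightarrow> cbilinear (\<lambda>a b. \<omega> a *\<^sub>C b)"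
  by (rule cbilinearI)
    (simp_all add: clinear_add clinear_scale scaleC_add_left scaleC_add_right scaleC_scaleC
      scaleC_complex_def mult.commute)

lemma cbilinear_slice_right: "clinear \<omega> \<Longrightarrow> cbilinear (\<lambda>a b. \<omega> b *\<^sub>C a)"
  by (rule cbilinearI)
    (simp_all add: clinear_add clinear_scale scaleC_add_left scaleC_add_right scaleC_scaleC
      scaleC_complex_def mult.commute)

lemma slice_left_tens: "clinear \<omega> \<Longrightarrow> slice_left \<omega> (a \<otimes> b) = \<omega> a *\<^sub>C b"
  unfolding slice_left_def by (rule tlift_tens[OF cbilinear_slice_left])

lemma slice_right_tens: "clinear \<omega> \<Longrightarrow> slice_right \<omega> (a \<otimes> b) = \<omega> b *\<^sub>C a"
  unfolding slice_right_def by (rule tlift_tens[OF cbilinear_slice_right])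

lemma clinear_slice_left: "clinear \<omega> \<Longrightarrow> clinear (slice_left \<omega>)"
  unfolding slice_left_def by (rule clinear_tlift[OF cbilinear_slice_left])

lemma clinear_slice_right: "clinear \<omega> \<Longrightarrow> clinear (slice_right \<omega>)"
  unfolding slice_right_def by (rule clinear_tlift[OF cbilinear_slice_right])

lemma slice_fubini:
  assumes "clinear \<omega>" "clinear \<phi>"
  shows "\<phi> (slice_left \<omega> t) = \<omega> (slice_right \<phi> t)"
  using assms
  by (induction t rule: tensor_induct)
    (simp_all add: slice_left_tens slice_right_tens clinear_add[OF clinear_slice_left]
      clinear_add[OF clinear_slice_right] clinear_add clinear_scale scaleC_complex_def mult.commute)

text \<open>A tensor is a finite sum of elementary tensors \<open>a \<otimes> b\<close>, and their first entries serve for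
  all functionals at once.\<close>

lemma slice_right_in_finite_span:
  "\<exists>P. finite P \<and> (\<forall>\<phi>. clinear \<phi> \<longrightarrow> slice_right \<phi> t \<in> cvec.span P)"
proof (induction t rule: tensor_induct)
  case (tens a b)
  show ?case
    by (rule exI[of _ "{a}"]) (auto simp: slice_right_tens intro: cvec.span_scale cvec.span_base)
next
  case (add x y)
  then obtain P Q where
    "finite P" "\<And>\<phi>. clinear \<phi> \<Longrightarrow> slice_right \<phi> x \<in> cvec.span P"
    "finite Q" "\<And>\<phi>. clinear \<phi> \<Longrightarrow> slice_right \<phi> y \<in> cvec.span Q"
    by blast
  then show ?case
    by (intro exI[of _ "P \<union> Q"])
      (auto simp: clinear_add[OF clinear_slice_right] cvec.span_Un)
qed

lemma slice_left_in_finite_span: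
  "\<exists>P. finite P \<and> (\<forall>\<omega>. clinear \<omega> \<longrightarrow> slice_left \<omega> t \<in> cvec.span P)"
proof (induction t rule: tensor_induct)
  case (tens a b)
  show ?case
    by (rule exI[of _ "{b}"]) (auto simp: slice_left_tens intro: cvec.span_scale cvec.span_base)
next
  case (add x y)
  then obtain P Q where
    "finite P" "\<And>\<omega>. clinear \<omega> \<Longrightarrow> slice_left \<omega> x \<in> cvec.span P"
    "finite Q" "\<And>\<omega>. clinear \<omega> \<Longrightarrow> slice_left \<omega> y \<in> cvec.span Q"
    by blast
  then show ?case
    by (intro exI[of _ "P \<union> Q"])
      (auto simp: clinear_add[OF clinear_slice_left] cvec.span_Un)
qed

lemma clinear_representation:
  assumes "cvec.independent B" "cvec.span B = UNIV"
  shows "clinear (\<lambda>a. cvec.representation B a b)"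
  using assms
  by (intro clinearI)
    (simp_all add: cvec.representation_add cvec.representation_scale scaleC_complex_def)

lemma tensor_expand_basis:
  fixes t :: "'a::complex_vector \<otimes> 'b::complex_vector"
  assumes ind: "cvec.independent B" and span: "cvec.span B = UNIV"
  shows "\<exists>F. finite F \<and> F \<subseteq> B \<and>
    t = (\<Sum>b\<in>F. b \<otimes> slice_left (\<lambda>a. cvec.representation B a b) t)"
proof -
  let ?r = "\<lambda>b a. cvec.representation B a b"
  note lin = clinear_representation[OF ind span]
  \<comment> \<open>The expansion must hold over every larger index set, so that two summands can share one.\<close>
  have "\<exists>F. finite F \<and> F \<subseteq> B \<and>
      (\<forall>K. finite K \<longrightarrow> F \<subseteq> K \<longrightarrow> K \<subseteq> B \<longrightarrow> t = (\<Sum>b\<in>K. b \<otimes> slice_left (?r b) t))"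
  proof (induction t rule: tensor_induct)
    case (tens a c)
    let ?F = "{b. ?r b a \<noteq> 0}"
    have F: "finite ?F" "?F \<subseteq> B"
      using cvec.finite_representation cvec.representation_ne_zero by auto
    have "a \<otimes> c = (\<Sum>b\<in>K. b \<otimes> slice_left (?r b) (a \<otimes> c))"
      if K: "finite K" "?F \<subseteq> K" for K
    proof -
      have "a = (\<Sum>b\<in>?F. ?r b a *\<^sub>C b)"
        using cvec.sum_nonzero_representation_eq[OF ind] span by simp
      also have "\<dots> = (\<Sum>b\<in>K. ?r b a *\<^sub>C b)"
        by (rule sum.mono_neutral_left) (use K in auto)
      finally have "a \<otimes> c = (\<Sum>b\<in>K. ?r b a *\<^sub>C b) \<otimes> c" by simp
      also have "\<dots> = (\<Sum>b\<in>K. (?r b a *\<^sub>C b) \<otimes> c)"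
      proof -
        have "clinear (\<lambda>x::'a. x \<otimes> c)"
          by (rule clinearI) (simp_all add: tens_simps)
        then have "module_hom scaleC scaleC (\<lambda>x::'a. x \<otimes> c)"
          by (simp add: Vector_Spaces.linear_def)
        then show ?thesis by (rule module_hom.sum)
      qed
      also have "\<dots> = (\<Sum>b\<in>K. b \<otimes> slice_left (?r b) (a \<otimes> c))"
        by (simp add: slice_left_tens[OF lin] tens_simps)
      finally show ?thesis .
    qed
    then show ?case using F by blast
  next
    case (add x y)
    from add(1) obtain F where F: "finite F" "F \<subseteq> B"
      "\<And>K. finite K \<Longrightarrow> F \<subseteq> K \<Longrightarrow> K \<subseteq> B \<Longrightarrow> x = (\<Sum>b\<in>K. b \<otimes> slice_left (?r b) x)"
      by blast
    from add(2) obtain G where G: "finite G" "G \<subseteq> B"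
      "\<And>K. finite K \<Longrightarrow> G \<subseteq> K \<Longrightarrow> K \<subseteq> B \<Longrightarrow> y = (\<Sum>b\<in>K. b \<otimes> slice_left (?r b) y)"
      by blast
    have "x + y = (\<Sum>b\<in>K. b \<otimes> slice_left (?r b) (x + y))"
      if "finite K" "F \<union> G \<subseteq> K" "K \<subseteq> B" for K
      using F(3)[of K] G(3)[of K] that
      by (simp add: clinear_add[OF clinear_slice_left[OF lin]] tens_simps sum.distrib)
    then show ?case
      using F(1,2) G(1,2) by (intro exI[of _ "F \<union> G"]) simp
  qed
  then show ?thesis by blast
qed

text \<open>Functionals detect membership in \<open>V \<otimes> B\<close>: expand the first leg in a basis that extends one
  of \<open>V\<close>.  The coordinate functionals of the additional basis vectors vanish on \<open>V\<close>, so these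
  vectors do not contribute.\<close>

lemma tensor_in_subspace_tensor:
  fixes t :: "'a::complex_vector \<otimes> 'b::complex_vector"
  assumes V: "cvec.subspace V"
    and t: "\<And>\<omega>. clinear \<omega> \<Longrightarrow> (\<And>v. v \<in> V \<Longrightarrow> \<omega> v = 0) \<Longrightarrow> slice_left \<omega> t = 0"
  shows "t \<in> cvec.span {v \<otimes> b | v b. v \<in> V}"
proof -
  obtain C where C: "C \<subseteq> V" "cvec.independent C" "V \<subseteq> cvec.span C"
    using cvec.maximal_independent_subset[of V] by blast
  define B where "B = cvec.extend_basis C"
  have B: "cvec.independent B" "cvec.span B = UNIV" "C \<subseteq> B"
    using cvec.independent_extend_basis[OF C(2)] cvec.span_extend_basis[OF C(2)]
      cvec.extend_basis_superset[OF C(2)] by (simp_all add: B_def)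
  let ?r = "\<lambda>b a. cvec.representation B a b"
  have vanish: "slice_left (?r b) t = 0" if b: "b \<notin> C" for b
  proof (rule t[OF clinear_representation[OF B(1,2)]])
    fix v assume "v \<in> V"
    then have "v \<in> cvec.span C" using C by blast
    then have "cvec.representation B v = cvec.representation C v"
      by (rule cvec.representation_extend[OF B(1) _ B(3)])
    then show "?r b v = 0"
      using b cvec.representation_ne_zero[of C v b] by metis
  qed
  obtain F where F: "finite F" "t = (\<Sum>b\<in>F. b \<otimes> slice_left (?r b) t)"
    using tensor_expand_basis[OF B(1,2), of t] by blast
  have zero: "b \<otimes> (0 :: 'b) = 0" for b :: 'a
    using tens_simps(4)[of b 0 "0 :: 'b"] by simp
  have "(\<Sum>b\<in>F. b \<otimes> slice_left (?r b) t) \<in> cvec.span {v \<otimes> b | v b. v \<in> V}"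
  proof (rule cvec.span_sum)
    fix b
    show "b \<otimes> slice_left (?r b) t \<in> cvec.span {v \<otimes> b | v b. v \<in> V}"
    proof (cases "b \<in> C")
      case True
      then show ?thesis using C(1) by (intro cvec.span_base) blast
    qed (simp add: vanish zero cvec.span_zero)
  qed
  then show ?thesis using F(2) by simp
qed


section \<open>Multipliers of a unital algebra\<close>

lemma clinear_mul_of: "clinear mul_of"
  by (rule clinearI; transfer)
    (simp_all add: fun_eq_iff distrib_left distrib_right mult_scaleC_left mult_scaleC_right)

lemma mul_of_times: "mul_of (a * b) = mul_of a * mul_of b"
  by (rule multiplier_eqI) (simp_all add: mult.assoc)

lemma mtransport_mul_of:
  assumes "algebra_hom f" "bij f"
  shows "mtransport f (mul_of a) = mul_of (f a)"
proof (rule multiplier_eqI)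
  fix x
  obtain y where y: "x = f y" using assms(2) by (metis bij_pointE)
  show "mtransport f (mul_of a) \<triangleright> x = mul_of (f a) \<triangleright> x"
    "x \<triangleleft> mtransport f (mul_of a) = x \<triangleleft> mul_of (f a)"
    using assms(1) by (simp_all add: y mtransport_apply[OF assms] algebra_hom_def)
qed

locale algebra_unit =
  fixes e :: "'a::complex_algebra"
  assumes unit_left: "e * a = a" and unit_right: "a * e = a"
begin

lemma mul_of_mleft_unit: "mul_of (m \<triangleright> e) = m"
proof (rule multiplier_eqI)
  fix x
  show "mul_of (m \<triangleright> e) \<triangleright> x = m \<triangleright> x"
    by (simp add: unit_left flip: mleft_mult)
  show "x \<triangleleft> mul_of (m \<triangleright> e) = x \<triangleleft> m"
    by (simp add: mult_mleft unit_right)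
qed

lemma elt_of_mul_of: "elt_of (mul_of a) = a" for a :: 'a
proof -
  have "inj (mul_of :: 'a \<Rightarrow> _)"
    by (rule injI) (metis mleft_mul_of unit_right)
  then show ?thesis by (simp add: elt_of_def)
qed

lemma elt_of_eq: "elt_of m = m \<triangleright> e"
  by (metis elt_of_mul_of mul_of_mleft_unit)

lemma mul_of_elt_of: "mul_of (elt_of m) = m" for m :: "'a multiplier"
  by (simp add: elt_of_eq mul_of_mleft_unit)

lemma mul_of_unit: "mul_of e = 1"
  by (rule multiplier_eqI) (simp_all add: unit_left unit_right)

lemma elt_of_times: "elt_of (m * n) = elt_of m * elt_of n" for m n :: "'a multiplier"
  by (simp add: elt_of_eq unit_left flip: mleft_mult)

lemma clinear_elt_of: "clinear (elt_of :: 'a multiplier \<Rightarrow> 'a)"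
  unfolding elt_of_eq
  by (rule clinearI) (transfer; simp)+

lemma mleft_elt: "m \<triangleright> x = elt_of m * x" for m :: "'a multiplier"
  by (metis mul_of_elt_of mleft_mul_of)

lemma mright_elt: "x \<triangleleft> m = x * elt_of m" for m :: "'a multiplier"
  by (metis mul_of_elt_of mright_mul_of)

text \<open>Every multiplier comes from an element, so there is nothing left to extend.\<close>

lemma hom_extension_elt_of:
  fixes f :: "'a \<Rightarrow> 'b::complex_algebra multiplier"
  assumes f: "algebra_hom f"
  shows "hom_extension f (f e) x = f (elt_of x)"
proof -
  have "hom_extension f (f e) = (\<lambda>x. f (elt_of x))"
    unfolding hom_extension_def
  proof (rule the_equality, intro conjI allI)
    show "algebra_hom (\<lambda>x. f (elt_of x))"
      using f clinear_compose[OF _ clinear_elt_of, of f]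
      by (simp add: algebra_hom_def elt_of_times)
    show "f (elt_of (mul_of x)) = f x" for x by (simp add: elt_of_mul_of)
    show "f (elt_of 1) = f e" by (simp add: elt_of_eq)
  next
    fix F assume "algebra_hom F \<and> (\<forall>x. F (mul_of x) = f x) \<and> F 1 = f e"
    then show "F = (\<lambda>x. f (elt_of x))" by (metis mul_of_elt_of)
  qed
  then show ?thesis by simp
qed

end

lemma algebra_unit_tensor:
  assumes "algebra_unit e" "algebra_unit f"
  shows "algebra_unit (e \<otimes> f)"
proof
  fix t
  show "e \<otimes> f * t = t"
    by (induction t rule: tensor_induct)
      (simp_all add: tens_mult_tens algebra_unit.unit_left assms distrib_left)
  show "t * (e \<otimes> f) = t"
    by (induction t rule: tensor_induct)
      (simp_all add: tens_mult_tens algebra_unit.unit_right assms distrib_right)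
qed


section \<open>The structure maps in the unital case\<close>

locale unital_regular_weak_multiplier_hopf_algebra =
  regular_weak_multiplier_hopf_algebra \<Delta> \<epsilon> E G1 G2 S + algebra_unit e
  for \<Delta> :: "'a::complex_algebra \<Rightarrow> ('a \<otimes> 'a) multiplier"
    and \<epsilon> E G1 G2 S and e :: 'a
begin

sublocale unit2: algebra_unit "e \<otimes> e"
  by (rule algebra_unit_tensor) (rule algebra_unit_axioms)+

sublocale unit3: algebra_unit "e \<otimes> e \<otimes> e"
  by (rule algebra_unit_tensor) (rule algebra_unit_axioms unit2.algebra_unit_axioms)+

text \<open>The identity makes multipliers and elements the same thing.  The copies of \<open>\<Delta>\<close>, \<open>E\<close>, \<open>S\<close> and
  \<open>\<epsilon>\<^sub>t\<close> with values in \<open>A\<close> and \<open>A \<otimes> A\<close> allow identities to be proved by induction on tensors.\<close>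

definition cop :: "'a \<Rightarrow> 'a \<otimes> 'a" where "cop a = elt_of (\<Delta> a)"

definition idem :: "'a \<otimes> 'a" where "idem = elt_of E"

definition anti :: "'a \<Rightarrow> 'a" where "anti a = elt_of (S a)"

definition eps :: "'a \<Rightarrow> 'a" where "eps a = tlift (\<lambda>p q. p * anti q) (cop a)"

lemma mul_of_cop: "mul_of (cop a) = \<Delta> a"
  by (simp add: cop_def unit2.mul_of_elt_of)

lemma clinear_cop: "clinear cop"
  using coproduct_hom clinear_compose[OF unit2.clinear_elt_of, of \<Delta>]
  by (simp add: cop_def[abs_def] algebra_hom_def)

lemma cop_mult: "cop (a * b) = cop a * cop b"
  using coproduct_hom by (simp add: cop_def algebra_hom_def unit2.elt_of_times)

lemma elt_of_mtens: "elt_of (mul_of a \<otimes>\<^sub>M mul_of b) = a \<otimes> b" for a b :: 'a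
  by (simp add: mtens_mul_of unit2.elt_of_mul_of)

lemma elt_of_mtens_one: "elt_of (1 \<otimes>\<^sub>M mul_of b) = e \<otimes> b" "elt_of (mul_of a \<otimes>\<^sub>M 1) = a \<otimes> e"
  for a b :: 'a
  using elt_of_mtens[of e b] elt_of_mtens[of a e] by (simp_all add: mul_of_unit)

lemma T1_tens: "T1 \<Delta> (a \<otimes> b) = cop a * (e \<otimes> b)"
  and clinear_T1: "clinear (T1 \<Delta>)"
proof -
  have eq: "elt_of (\<Delta> a * (1 \<otimes>\<^sub>M mul_of b)) = cop a * (e \<otimes> b)" for a b
    by (simp add: unit2.elt_of_times elt_of_mtens_one cop_def)
  have bil: "cbilinear (\<lambda>a b. cop a * (e \<otimes> b))"
    by (rule cbilinearI) (simp_all add: clinear_add[OF clinear_cop] clinear_scale[OF clinear_cop]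
        tens_simps distrib_left distrib_right mult_scaleC_left mult_scaleC_right)
  show "T1 \<Delta> (a \<otimes> b) = cop a * (e \<otimes> b)" "clinear (T1 \<Delta>)"
    unfolding T1_def eq by (rule tlift_tens[OF bil] clinear_tlift[OF bil])+
qed

lemma T2_tens: "T2 \<Delta> (a \<otimes> b) = (a \<otimes> e) * cop b"
  and clinear_T2: "clinear (T2 \<Delta>)"
proof -
  have eq: "elt_of ((mul_of a \<otimes>\<^sub>M 1) * \<Delta> b) = (a \<otimes> e) * cop b" for a b
    by (simp add: unit2.elt_of_times elt_of_mtens_one cop_def)
  have bil: "cbilinear (\<lambda>a b. (a \<otimes> e) * cop b)"
    by (rule cbilinearI) (simp_all add: clinear_add[OF clinear_cop] clinear_scale[OF clinear_cop]
        tens_simps distrib_left distrib_right mult_scaleC_left mult_scaleC_right)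
  show "T2 \<Delta> (a \<otimes> b) = (a \<otimes> e) * cop b" "clinear (T2 \<Delta>)"
    unfolding T2_def eq by (rule tlift_tens[OF bil] clinear_tlift[OF bil])+
qed

lemma idem_idem: "idem * idem = idem"
  using E_idempotent by (metis idem_def unit2.elt_of_times)

lemma idem_cop: "idem * cop a = cop a"
proof -
  have "cop a \<in> range (T1 \<Delta>)"
    using T1_tens[of a e] by (metis rangeI unit2.unit_right)
  then obtain t where "cop a = idem * t"
    using E_range(1) by (auto simp: unit2.mleft_elt idem_def)
  then show ?thesis by (metis idem_idem mult.assoc)
qed

text \<open>\<open>E\<close> is a left identity for the range of \<open>T1\<close>, which contains \<open>\<Delta>(e)\<close>, while \<open>\<Delta>(e)\<close> is a right
  identity for the range of \<open>T2\<close>, which contains \<open>E\<close>.  So both equal \<open>E \<Delta>(e)\<close>.\<close>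

lemma cop_unit: "cop e = idem"
proof -
  have "idem \<in> range (T2 \<Delta>)"
    using E_range(2) by (metis idem_def rangeI unit2.mright_elt unit2.unit_left)
  then obtain t where t: "idem = T2 \<Delta> t" by blast
  have "T2 \<Delta> t * cop e = T2 \<Delta> t" for t
    by (induction t rule: tensor_induct)
      (simp_all add: T2_tens clinear_add[OF clinear_T2] distrib_right mult.assoc unit_right
        flip: cop_mult)
  then have "idem * cop e = idem" using t by metis
  then show ?thesis using idem_cop by simp
qed

lemma Delta_unit: "\<Delta> e = E"
  using cop_unit by (metis mul_of_cop idem_def unit2.mul_of_elt_of)

lemma coproduct_id_eq:
  "coproduct_id \<Delta> t = mul_of (tensor_assoc (map_tensor cop (\<lambda>x. x) t))"
proof -
  have eq: "mtransport tensor_assoc (\<Delta> a \<otimes>\<^sub>M mul_of b) = mul_of (tensor_assoc (cop a \<otimes> b))" for a b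
    by (simp add: mtransport_mul_of[OF tensor_assoc_iso] mtens_mul_of flip: mul_of_cop)
  have bil: "cbilinear (\<lambda>a b. mul_of (tensor_assoc (cop a \<otimes> b)))"
    by (rule cbilinearI) (simp_all add: clinear_add[OF clinear_cop] clinear_scale[OF clinear_cop]
        tens_simps clinear_add[OF clinear_mul_of] clinear_scale[OF clinear_mul_of]
        clinear_add[OF clinear_tensor_assoc] clinear_scale[OF clinear_tensor_assoc])
  show ?thesis
    unfolding coproduct_id_def eq
    by (rule tensor_ext[OF clinear_tlift[OF bil]])
      (simp_all add: tlift_tens[OF bil] map_tensor_tens clinear_cop clinear_ident
        clinear_compose[OF clinear_mul_of] clinear_compose[OF clinear_tensor_assoc]
        clinear_map_tensor)
qed

lemma id_coproduct_eq: "id_coproduct \<Delta> t = mul_of (map_tensor (\<lambda>x. x) cop t)"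
proof -
  have eq: "mul_of a \<otimes>\<^sub>M \<Delta> b = mul_of (a \<otimes> cop b)" for a b
    by (simp add: mtens_mul_of flip: mul_of_cop)
  have bil: "cbilinear (\<lambda>a b. mul_of (a \<otimes> cop b))"
    by (rule cbilinearI) (simp_all add: clinear_add[OF clinear_cop] clinear_scale[OF clinear_cop]
        tens_simps clinear_add[OF clinear_mul_of] clinear_scale[OF clinear_mul_of])
  show ?thesis
    unfolding id_coproduct_def eq
    by (rule tensor_ext[OF clinear_tlift[OF bil]])
      (simp_all add: tlift_tens[OF bil] map_tensor_tens clinear_cop clinear_ident
        clinear_compose[OF clinear_mul_of] clinear_map_tensor)
qed

lemma coassociative_cop:
  "tensor_assoc (map_tensor cop (\<lambda>x. x) (cop a)) = map_tensor (\<lambda>x. x) cop (cop a)"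
proof -
  have "coproduct_id \<Delta> (cop a) = id_coproduct \<Delta> (cop a)"
    using coassociative[of e a e]
    by (simp add: mul_of_unit mtens_one T1_tens T2_tens unit2.unit_left unit2.unit_right)
  then show ?thesis
    unfolding coproduct_id_eq id_coproduct_eq by (metis unit3.elt_of_mul_of)
qed

lemma id_cop_idem: "map_tensor (\<lambda>x. x) cop idem = tensor_assoc (idem \<otimes> e) * (e \<otimes> idem)"
proof -
  let ?f = "map_tensor (\<lambda>x. x) cop"
  note lin = clinear_map_tensor[OF clinear_ident clinear_cop]
  have mult: "?f (t * u) = ?f t * ?f u" for t u
  proof (induction t rule: tensor_induct)
    case (tens a b)
    show ?case
      by (induction u rule: tensor_induct)
        (simp_all add: tens_mult_tens cop_mult map_tensor_tens[OF clinear_ident clinear_cop]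
          clinear_add[OF lin] distrib_left)
  qed (simp add: clinear_add[OF lin] distrib_right)
  have hom: "algebra_hom (id_coproduct \<Delta>)"
    unfolding algebra_hom_def id_coproduct_eq
    by (auto simp: mult mul_of_times intro: clinear_compose[OF clinear_mul_of lin])
  have unit: "id_coproduct \<Delta> (e \<otimes> e) = 1 \<otimes>\<^sub>M E"
    by (simp add: id_coproduct_eq map_tensor_tens[OF clinear_ident clinear_cop] mul_of_cop
        Delta_unit mul_of_unit flip: mtens_mul_of)
  have legs: "leg12 E = mul_of (tensor_assoc (idem \<otimes> e))"
    "(leg23 E :: ('a \<otimes> 'a \<otimes> 'a) multiplier) = mul_of (e \<otimes> idem)"
    by (simp_all add: leg12_def leg23_def mtens_mul_of[symmetric]
        mul_of_unit idem_def unit2.mul_of_elt_of mtransport_mul_of[OF tensor_assoc_iso, symmetric])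
  have "id_coproduct \<Delta> idem = leg12 E * leg23 E"
    using id_coproduct_E(1) unit2.hom_extension_elt_of[OF hom, of E] by (simp add: unit idem_def)
  then show ?thesis
    unfolding legs id_coproduct_eq by (metis mul_of_times unit3.elt_of_mul_of)
qed

lemma target_algebra_iff: "x \<in> target_algebra \<Delta> E \<longleftrightarrow> cop (elt_of x) = (elt_of x \<otimes> e) * idem"
proof -
  have "hom_extension \<Delta> E x = \<Delta> (elt_of x)"
    using hom_extension_elt_of[OF coproduct_hom] by (simp add: Delta_unit)
  moreover have "(x \<otimes>\<^sub>M 1) * E = mul_of ((elt_of x \<otimes> e) * idem)"
    by (simp add: mul_of_times mul_of_unit mul_of_elt_of unit2.mul_of_elt_of idem_def
        flip: mtens_mul_of)
  ultimately show ?thesis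
    unfolding target_algebra_def by simp (metis cop_def mul_of_cop unit2.elt_of_mul_of)
qed

section \<open>The antipode and the target map\<close>

lemma S_eq: "S a = mul_of (anti a)"
  by (simp add: anti_def mul_of_elt_of)

lemma clinear_anti: "clinear anti"
  using antipode clinear_compose[OF clinear_elt_of, of S]
  by (simp add: anti_def[abs_def] is_antipode_def)

lemma surj_anti: "surj anti"
proof (rule surjI)
  fix a
  have "mul_of a \<in> S ` UNIV" using regular by (auto simp: bij_betw_def)
  then show "anti (inv S (mul_of a)) = a"
    by (metis f_inv_into_f S_eq elt_of_mul_of)
qed

lemma cbilinear_anti_right: "cbilinear (\<lambda>p q. p \<otimes> (anti q * b))"
  by (rule cbilinearI) (simp_all add: clinear_add[OF clinear_anti] clinear_scale[OF clinear_anti]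
      tens_simps distrib_right mult_scaleC_left)

lemma cbilinear_anti_left: "cbilinear (\<lambda>p q. (a * anti p) \<otimes> q)"
  by (rule cbilinearI) (simp_all add: clinear_add[OF clinear_anti] clinear_scale[OF clinear_anti]
      tens_simps distrib_left mult_scaleC_right)

lemma cbilinear_mult_anti: "cbilinear (\<lambda>p q. p * anti q)"
  by (rule cbilinearI) (simp_all add: clinear_add[OF clinear_anti] clinear_scale[OF clinear_anti]
      distrib_left mult_scaleC_right distrib_right mult_scaleC_left)

lemma cbilinear_anti_mult: "cbilinear (\<lambda>p q. anti p * f q)" if "clinear f"
  for f :: "'b::complex_vector \<Rightarrow> 'a"
  by (rule cbilinearI) (simp_all add: clinear_add[OF clinear_anti] clinear_scale[OF clinear_anti]
      clinear_add[OF that] clinear_scale[OF that]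
      distrib_left mult_scaleC_right distrib_right mult_scaleC_left)

text \<open>With the identity available as a covering element, the auxiliary maps \<open>R1\<close> and \<open>R2\<close> of the
  antipode are determined outright, and the Sweedler formulas for \<open>S\<close> become equations in
  \<open>A \<otimes> A\<close> without coverings.\<close>

lemma antipode_unital:
  shows idem_right: "idem * (a \<otimes> b) = T1 \<Delta> (tlift (\<lambda>p q. p \<otimes> (anti q * b)) (cop a))"
    and idem_left: "(a \<otimes> b) * idem = T2 \<Delta> (tlift (\<lambda>p q. (a * anti p) \<otimes> q) (cop b))"
    and antipode_convolution: "tlift (\<lambda>p q. anti p * q) (idem * (a \<otimes> e)) = anti a"
proof -
  obtain R1 R2 where
    R1': "\<forall>a b c. (mul_of c \<otimes>\<^sub>M 1) \<triangleright> R1 (a \<otimes> b) = tlift (\<lambda>p q. p \<otimes> (S q \<triangleright> b)) (T2 \<Delta> (c \<otimes> a))" and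
    R2': "\<forall>a b c. R2 (a \<otimes> b) \<triangleleft> (1 \<otimes>\<^sub>M mul_of c) = tlift (\<lambda>p q. (a \<triangleleft> S p) \<otimes> q) (T1 \<Delta> (b \<otimes> c))" and
    ER': "\<forall>a b. E \<triangleright> (a \<otimes> b) = T1 \<Delta> (R1 (a \<otimes> b))" "\<forall>a b. (a \<otimes> b) \<triangleleft> E = T2 \<Delta> (R2 (a \<otimes> b))" and
    conv': "\<forall>a b. tlift (\<lambda>p q. S p \<triangleright> q) (T1 \<Delta> (R1 (a \<otimes> b))) = S a \<triangleright> b"
    using antipode unfolding is_antipode_def by (elim exE conjE) (rule that)
  note R1 = R1'[rule_format] and R2 = R2'[rule_format] and ER = ER'[rule_format]
    and conv = conv'[rule_format]
  have "R1 (a \<otimes> b) = tlift (\<lambda>p q. p \<otimes> (anti q * b)) (cop a)" for a b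
    using R1[of e a b]
    by (simp add: mul_of_unit mtens_one T2_tens unit2.unit_left S_eq)
  then show "idem * (a \<otimes> b) = T1 \<Delta> (tlift (\<lambda>p q. p \<otimes> (anti q * b)) (cop a))" for b
    using ER(1)[of a b] by (simp add: unit2.mleft_elt idem_def)
  have "R2 (a \<otimes> b) = tlift (\<lambda>p q. (a * anti p) \<otimes> q) (cop b)"
    using R2[of a b e]
    by (simp add: mul_of_unit mtens_one T1_tens unit2.unit_right S_eq)
  then show "(a \<otimes> b) * idem = T2 \<Delta> (tlift (\<lambda>p q. (a * anti p) \<otimes> q) (cop b))"
    using ER(2)[of a b] by (simp add: unit2.mright_elt idem_def)
  have "mleft (mul_of p) = (*) p" for p :: 'a by (rule ext) simp
  then show "tlift (\<lambda>p q. anti p * q) (idem * (a \<otimes> e)) = anti a"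
    using conv[of a e] ER(1)[of a e] by (simp add: S_eq unit_right unit2.mleft_elt idem_def)
qed

lemma eps_t_eq: "eps_t \<Delta> S a = mul_of (eps a)"
proof -
  have lin: "clinear (tlift (\<lambda>p q. p * anti q))"
    by (rule clinear_tlift[OF cbilinear_mult_anti])
  have left: "tlift (\<lambda>p q. p * anti q) ((c \<otimes> e) * t) = c * tlift (\<lambda>p q. p * anti q) t" for c t
    by (induction t rule: tensor_induct)
      (simp_all add: tens_mult_tens unit_left tlift_tens[OF cbilinear_mult_anti] mult.assoc
        distrib_left clinear_add[OF lin])
  show ?thesis
    unfolding eps_t_def
  proof (rule the_equality)
    show "\<forall>c. c \<triangleleft> mul_of (eps a) = tlift (\<lambda>p q. p \<triangleleft> S q) (T2 \<Delta> (c \<otimes> a))"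
      by (simp add: S_eq T2_tens left eps_def)
    show "y = mul_of (eps a)"
      if "\<forall>c. c \<triangleleft> y = tlift (\<lambda>p q. p \<triangleleft> S q) (T2 \<Delta> (c \<otimes> a))" for y
    proof -
      have "e \<triangleleft> y = eps a"
        using that[rule_format, of e] by (simp add: S_eq T2_tens unit2.unit_left eps_def)
      then show ?thesis by (metis mright_elt unit_left mul_of_elt_of)
    qed
  qed
qed

lemma clinear_eps: "clinear eps"
  unfolding eps_def[abs_def]
  by (rule clinear_compose[OF clinear_tlift[OF cbilinear_mult_anti] clinear_cop])

text \<open>This is \<open>\<Sum> S(a\<^sub>1) a\<^sub>2 S(a\<^sub>3) = S(a)\<close>.  The antipode axiom brackets the triple coproduct as
  \<open>(\<Delta> \<otimes> id) \<Delta>(a)\<close>, whereas \<open>eps\<close> needs \<open>(id \<otimes> \<Delta>) \<Delta>(a)\<close>; the two are related by applying the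
  map \<open>m : p \<otimes> q \<otimes> r \<mapsto> S(p) q S(r)\<close> to coassociativity.\<close>

lemma anti_convolution_eps: "tlift (\<lambda>p q. anti p * eps q) (cop a) = anti a"
proof -
  define n where "n = tlift (\<lambda>q r. q * anti r)"
  define m where "m = tlift (\<lambda>p u. anti p * n u)"
  have lin_n: "clinear n" and n_tens: "n (q \<otimes> r) = q * anti r" for q r
    by (simp_all add: n_def tlift_tens[OF cbilinear_mult_anti] clinear_tlift[OF cbilinear_mult_anti])
  have n_cop: "n (cop q) = eps q" for q
    by (simp add: n_def eps_def)
  note bil = cbilinear_anti_mult[OF lin_n] and bil' = cbilinear_anti_mult[OF clinear_ident]
    and bil_e = cbilinear_anti_right[of e, unfolded unit_right]
  have lin_m: "clinear m" and m_tens: "m (p \<otimes> u) = anti p * n u" for p u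
    by (simp_all add: m_def tlift_tens[OF bil] clinear_tlift[OF bil])
  have "tlift (\<lambda>p q. anti p * eps q) t = m (map_tensor (\<lambda>x. x) cop t)" for t
    by (rule tensor_ext[OF clinear_tlift[OF cbilinear_anti_mult[OF clinear_eps]]
          clinear_compose[OF lin_m clinear_map_tensor[OF clinear_ident clinear_cop]]])
      (simp add: m_tens n_cop map_tensor_tens[OF clinear_ident clinear_cop]
        tlift_tens[OF cbilinear_anti_mult[OF clinear_eps]])
  moreover have "m (tensor_assoc (u \<otimes> r)) = tlift (\<lambda>p q. anti p * q) (u * (e \<otimes> anti r))" for u r
    by (induction u rule: tensor_induct)
      (simp_all add: tensor_assoc_tens m_tens n_tens
        tlift_tens[OF bil'] tens_mult_tens unit_right distrib_right tens_simps
        clinear_add[OF clinear_tensor_assoc] clinear_add[OF lin_m]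
        clinear_add[OF clinear_tlift[OF bil']])
  then have "m (tensor_assoc (map_tensor cop (\<lambda>x. x) t)) =
      tlift (\<lambda>p q. anti p * q) (T1 \<Delta> (tlift (\<lambda>p q. p \<otimes> (anti q * e)) t))" for t
    by (induction t rule: tensor_induct)
      (simp_all add: map_tensor_tens[OF clinear_cop clinear_ident] tlift_tens[OF bil_e]
        T1_tens unit_right clinear_add[OF clinear_tensor_assoc] clinear_add[OF lin_m]
        clinear_add[OF clinear_tlift[OF bil']] clinear_add[OF clinear_T1]
        clinear_add[OF clinear_tlift[OF bil_e]]
        clinear_add[OF clinear_map_tensor[OF clinear_cop clinear_ident]])
  ultimately show ?thesis
    using coassociative_cop antipode_convolution idem_right by metis
qed

text \<open>Apply \<open>\<epsilon> \<otimes> id\<close> to \<open>E (a \<otimes> 1) = \<Sum> a\<^sub>1 \<otimes> a\<^sub>2 S(a\<^sub>3)\<close>.\<close>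

lemma eps_eq_slice: "eps a = slice_left \<epsilon> (idem * (a \<otimes> e))"
proof -
  note bil_e = cbilinear_anti_right[of e, unfolded unit_right]
  have "slice_left \<epsilon> (T1 \<Delta> (tlift (\<lambda>p q. p \<otimes> anti q) t)) = tlift (\<lambda>p q. p * anti q) t" for t
    by (rule tensor_ext[OF clinear_compose[OF clinear_slice_left[OF counit_linear]
            clinear_compose[OF clinear_T1 clinear_tlift[OF bil_e]]]
          clinear_tlift[OF cbilinear_mult_anti]])
      (simp add: tlift_tens[OF bil_e] tlift_tens[OF cbilinear_mult_anti] counit)
  then show ?thesis by (simp add: eps_def idem_right unit_right)
qed

text \<open>\<open>\<epsilon>\<^sub>t\<close> takes values in \<open>A\<^sub>t\<close>.  As \<open>\<epsilon>\<^sub>t(x)\<close> is a slice of \<open>E (x \<otimes> 1)\<close>, its coproduct is the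
  slice of \<open>((id \<otimes> \<Delta>) E) (x \<otimes> 1 \<otimes> 1) = (E \<otimes> 1) (1 \<otimes> E) (x \<otimes> 1 \<otimes> 1)\<close>, and moving \<open>x\<close> past
  \<open>1 \<otimes> E\<close> turns this into \<open>(E (x \<otimes> 1) \<otimes> 1) (1 \<otimes> E)\<close>.\<close>

lemma cop_eps: "cop (eps x) = (eps x \<otimes> e) * idem"
proof -
  let ?f = "map_tensor (\<lambda>x. x) cop"
  note lin_f = clinear_map_tensor[OF clinear_ident clinear_cop]
  note lin_s = clinear_slice_left[OF counit_linear]
  have absorb: "cop a * idem = cop a" for a
    by (simp add: unit_right flip: cop_unit cop_mult)
  have 1: "cop (slice_left \<epsilon> (t * (x \<otimes> e))) = slice_left \<epsilon> (?f t * (x \<otimes> idem))" for t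
    by (induction t rule: tensor_induct)
      (simp_all add: tens_mult_tens unit_right map_tensor_tens[OF clinear_ident clinear_cop]
        slice_left_tens[OF counit_linear] absorb clinear_scale[OF clinear_cop]
        distrib_right clinear_add[OF lin_s] clinear_add[OF clinear_cop] clinear_add[OF lin_f])
  have tens: "slice_left \<epsilon> (tensor_assoc ((p \<otimes> q) \<otimes> e) * (x \<otimes> u)) = \<epsilon> (p * x) *\<^sub>C ((q \<otimes> e) * u)"
    for p q u
    by (simp add: tensor_assoc_tens tens_mult_tens slice_left_tens[OF counit_linear])
  have 2: "slice_left \<epsilon> (tensor_assoc (t \<otimes> e) * (x \<otimes> u)) = (slice_left \<epsilon> (t * (x \<otimes> e)) \<otimes> e) * u" for t u
    by (induction t rule: tensor_induct)
      (simp_all add: tens tens_mult_tens unit_right slice_left_tens[OF counit_linear] tens_simps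
        mult_scaleC_left distrib_right clinear_add[OF lin_s] clinear_add[OF clinear_tensor_assoc])
  have "?f idem * (x \<otimes> idem) = tensor_assoc (idem \<otimes> e) * (x \<otimes> idem)"
    by (simp add: id_cop_idem mult.assoc tens_mult_tens unit_left idem_idem)
  then show ?thesis
    by (simp add: eps_eq_slice 1 2)
qed

section \<open>Cointegrals, integrals and finite-dimensionality\<close>

lemma cointegral_space_iff: "h \<in> cointegral_space \<Delta> S \<longleftrightarrow> (\<forall>a. a * h = eps a * h)"
proof -
  have "mul_of a * mul_of h = eps_t \<Delta> S a * mul_of h \<longleftrightarrow> a * h = eps a * h" for a
    unfolding eps_t_eq mul_of_times[symmetric] by (metis elt_of_mul_of)
  moreover have "mul_of h = 0 \<longleftrightarrow> h = 0"
    by (metis clinear_zero clinear_mul_of elt_of_mul_of)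
  ultimately show ?thesis
    unfolding cointegral_space_def left_cointegral_def mem_Collect_eq by (metis mult_zero_right)
qed

text \<open>Expand \<open>(1 \<otimes> a) E\<close> as \<open>\<Sum> (S(a\<^sub>1) \<otimes> 1) \<Delta>(a\<^sub>2)\<close> and use that \<open>E\<close> fixes \<open>\<Delta>(h)\<close>.\<close>

lemma cop_cointegral:
  assumes "h \<in> cointegral_space \<Delta> S"
  shows "(e \<otimes> a) * cop h = (anti a \<otimes> e) * cop h"
proof -
  have step: "(p \<otimes> e) * (cop q * cop h) = ((p * eps q) \<otimes> e) * cop h" for p q
  proof -
    have "cop q * cop h = cop (eps q) * cop h"
      using assms by (metis cointegral_space_iff cop_mult)
    also have "\<dots> = (eps q \<otimes> e) * cop h"
      by (simp add: cop_eps mult.assoc idem_cop)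
    finally show ?thesis
      by (simp add: tens_mult_tens unit_left flip: mult.assoc)
  qed
  note bil = cbilinear_anti_mult[OF clinear_eps]
    and bil_e = cbilinear_anti_left[of e, unfolded unit_left]
  have "T2 \<Delta> (tlift (\<lambda>p q. anti p \<otimes> q) t) * cop h
      = (tlift (\<lambda>p q. anti p * eps q) t \<otimes> e) * cop h" for t
    by (induction t rule: tensor_induct)
      (simp_all add: tlift_tens[OF bil_e] tlift_tens[OF bil] T2_tens unit_left
        mult.assoc step clinear_add[OF clinear_T2] clinear_add[OF clinear_tlift[OF bil]]
        clinear_add[OF clinear_tlift[OF bil_e]] distrib_right tens_simps)
  then have "(e \<otimes> a) * idem * cop h = (anti a \<otimes> e) * cop h"
    by (simp add: idem_left anti_convolution_eps unit_left)
  then show ?thesis by (simp add: mult.assoc idem_cop)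
qed

lemma left_integral_slice:
  assumes "left_integral \<Delta> E \<phi>"
  shows "cop (slice_right \<phi> (cop a)) = (slice_right \<phi> (cop a) \<otimes> e) * idem"
proof -
  obtain y where y: "y \<in> target_algebra \<Delta> E"
    "y \<triangleright> e = slice_right \<phi> (elt_of (\<Delta> a * (mul_of e \<otimes>\<^sub>M 1)))"
    using assms unfolding left_integral_def by blast
  then have "elt_of y = slice_right \<phi> (cop a)"
    by (simp add: elt_of_eq mul_of_unit mtens_one cop_def unit2.elt_of_eq)
  then show ?thesis using y(1) by (simp add: target_algebra_iff)
qed

text \<open>Apply \<open>\<epsilon> \<otimes> id\<close> to \<open>\<Delta>(y) = (y \<otimes> 1) E\<close>: this exhibits \<open>y\<close> as the slice of \<open>E\<close> by
  \<open>\<epsilon>(y \<cdot>)\<close>.\<close>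

lemma target_elements_in_finite_span:
  "\<exists>F. finite F \<and> (\<forall>y. cop y = (y \<otimes> e) * idem \<longrightarrow> y \<in> cvec.span F)"
proof -
  obtain F where F: "finite F" "\<And>\<omega>. clinear \<omega> \<Longrightarrow> slice_left \<omega> idem \<in> cvec.span F"
    using slice_left_in_finite_span[of idem] by blast
  have "y \<in> cvec.span F" if y: "cop y = (y \<otimes> e) * idem" for y
  proof -
    note lin = clinear_compose[OF counit_linear clinear_mult_left[of y]]
    have "slice_left \<epsilon> ((y \<otimes> e) * t) = slice_left (\<lambda>p. \<epsilon> (y * p)) t" for t
      by (induction t rule: tensor_induct)
        (simp_all add: tens_mult_tens unit_left slice_left_tens counit_linear lin
          clinear_add[OF clinear_slice_left] distrib_left)
    moreover have "y = slice_left \<epsilon> (cop y)"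
      using counit(1)[of y e] by (simp add: T1_tens unit_right unit2.unit_right)
    ultimately show ?thesis using F(2)[OF lin] y by metis
  qed
  then show ?thesis using F(1) by blast
qed

lemma slice_right_mult_left:
  assumes "clinear \<phi>"
  shows "slice_right \<phi> ((x \<otimes> e) * t) = x * slice_right \<phi> t"
  using assms
  by (induction t rule: tensor_induct)
    (simp_all add: tens_mult_tens unit_left slice_right_tens clinear_add[OF clinear_slice_right]
      distrib_left mult_scaleC_right)

lemma slice_right_mult_right:
  assumes "clinear \<phi>"
  shows "slice_right \<phi> ((e \<otimes> a) * t) = slice_right (\<lambda>b. \<phi> (a * b)) t"
  using assms clinear_compose[OF assms clinear_mult_left[of a]]
  by (induction t rule: tensor_induct)
    (simp_all add: tens_mult_tens unit_left slice_right_tens clinear_add[OF clinear_slice_right]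
      distrib_left)

lemma slice_left_mult_unit:
  assumes "clinear \<omega>"
  shows "slice_left \<omega> (t * (e \<otimes> c)) = slice_left \<omega> t * c"
  using assms
  by (induction t rule: tensor_induct)
    (simp_all add: tens_mult_tens unit_right slice_left_tens clinear_add[OF clinear_slice_left]
      distrib_right mult_scaleC_left)

text \<open>Left multiplication of a slice of \<open>\<Delta>(h)\<close> by \<open>S(a)\<close> only changes the functional from \<open>\<phi>\<close> to
  \<open>\<phi>(a \<cdot>)\<close>, and every element of \<open>A\<close> is some \<open>S(a)\<close>.\<close>

lemma left_ideal_of_slice_in_finite_span:
  assumes h: "h \<in> cointegral_space \<Delta> S" and \<phi>: "clinear \<phi>"
  shows "\<exists>P. finite P \<and> (\<forall>x. x * slice_right \<phi> (cop h) \<in> cvec.span P)"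
proof -
  obtain P where P: "finite P" "\<And>\<psi>. clinear \<psi> \<Longrightarrow> slice_right \<psi> (cop h) \<in> cvec.span P"
    using slice_right_in_finite_span[of "cop h"] by blast
  have "x * slice_right \<phi> (cop h) \<in> cvec.span P" for x
  proof -
    obtain a where a: "x = anti a" using surj_anti by blast
    have "x * slice_right \<phi> (cop h) = slice_right \<phi> ((anti a \<otimes> e) * cop h)"
      by (simp add: slice_right_mult_left[OF \<phi>] a)
    also have "\<dots> = slice_right (\<lambda>b. \<phi> (a * b)) (cop h)"
      by (simp add: slice_right_mult_right[OF \<phi>] flip: cop_cointegral[OF h])
    finally show ?thesis
      using P(2)[OF clinear_compose[OF \<phi> clinear_mult_left]] by simp
  qed
  then show ?thesis using P(1) by blast
qed

lemma finite_dimensional: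
  assumes faithful: "faithful_left_integrals \<Delta> E" and discrete: "discrete_type \<Delta> S"
  shows "\<exists>B :: 'a set. finite B \<and> cvec.span B = UNIV"
proof -
  define Y where "Y = {slice_right \<phi> (cop h) | \<phi> h. left_integral \<Delta> E \<phi> \<and> h \<in> cointegral_space \<Delta> S}"
  obtain F where F: "finite F" "\<And>y. cop y = (y \<otimes> e) * idem \<Longrightarrow> y \<in> cvec.span F"
    using target_elements_in_finite_span by blast
  have YF: "Y \<subseteq> cvec.span F"
    using left_integral_slice F(2) by (auto simp: Y_def)
  \<comment> \<open>\<open>C\<close> must consist of actual slices, not arbitrary elements of their span: only for slices is
    the generated left ideal known to be finite-dimensional.\<close>
  obtain C where C: "C \<subseteq> Y" "cvec.independent C" "Y \<subseteq> cvec.span C"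
    using cvec.maximal_independent_subset[of Y] by blast
  have fin_C: "finite C"
    using cvec.independent_span_bound[OF F(1) C(2)] C(1) YF by blast
  have "\<exists>P. finite P \<and> (\<forall>x. x * y \<in> cvec.span P)" if y: "y \<in> C" for y
  proof -
    obtain \<phi> h where "y = slice_right \<phi> (cop h)" "left_integral \<Delta> E \<phi>" "h \<in> cointegral_space \<Delta> S"
      using y C(1) by (auto simp: Y_def)
    then show ?thesis
      using left_ideal_of_slice_in_finite_span by (simp add: left_integral_def)
  qed
  then obtain P where P: "\<And>y. y \<in> C \<Longrightarrow> finite (P y)" "\<And>y x. y \<in> C \<Longrightarrow> x * y \<in> cvec.span (P y)"
    by metis
  define B where "B = (\<Union>y\<in>C. P y)"
  let ?V = "cvec.span B"
  have xY: "x * y \<in> ?V" if "y \<in> Y" for x y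
  proof -
    have "y \<in> cvec.span C" using that C(3) by blast
    then show ?thesis
    proof (induction rule: cvec.span_induct_alt)
      case base
      then show ?case by (simp add: cvec.span_zero)
    next
      case (step c y z)
      have "x * y \<in> ?V"
        using P(2)[OF step(1), of x] cvec.span_mono[of "P y" B] step(1) by (auto simp: B_def)
      then show ?case
        using step(2) by (simp add: distrib_left mult_scaleC_right cvec.span_add cvec.span_scale)
    qed
  qed
  have vanish: "slice_left \<omega> (cop h) = 0"
    if h: "h \<in> cointegral_space \<Delta> S" and \<omega>: "clinear \<omega>" "\<And>v. v \<in> ?V \<Longrightarrow> \<omega> v = 0" for h \<omega>
  proof -
    have "\<phi> (a * slice_left \<omega> (cop h)) = 0" if \<phi>: "left_integral \<Delta> E \<phi>" for \<phi> a
    proof -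
      have lin: "clinear \<phi>" using \<phi> by (simp add: left_integral_def)
      have "\<phi> (a * slice_left \<omega> (cop h)) = \<omega> (slice_right (\<lambda>b. \<phi> (a * b)) (cop h))"
        by (rule slice_fubini[OF \<omega>(1) clinear_compose[OF lin clinear_mult_left]])
      also have "slice_right (\<lambda>b. \<phi> (a * b)) (cop h) = slice_right \<phi> ((anti a \<otimes> e) * cop h)"
        by (simp add: slice_right_mult_right[OF lin] flip: cop_cointegral[OF h])
      also have "\<dots> = anti a * slice_right \<phi> (cop h)"
        by (rule slice_right_mult_left[OF lin])
      also have "\<omega> \<dots> = 0"
        by (rule \<omega>(2)[OF xY]) (use \<phi> h in \<open>auto simp: Y_def\<close>)
      finally show ?thesis .
    qed
    then show ?thesis using faithful by (simp add: faithful_left_integrals_def)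
  qed
  have "T1 \<Delta> (h \<otimes> c) \<in> cvec.span {v \<otimes> b | v b. v \<in> ?V}" if h: "h \<in> cointegral_space \<Delta> S" for h c
  proof (rule tensor_in_subspace_tensor[OF cvec.subspace_span])
    fix \<omega> :: "'a \<Rightarrow> complex" assume "clinear \<omega>" "\<And>v. v \<in> ?V \<Longrightarrow> \<omega> v = 0"
    then show "slice_left \<omega> (T1 \<Delta> (h \<otimes> c)) = 0"
      using vanish[OF h] by (simp add: T1_tens slice_left_mult_unit)
  qed
  then have "left_leg {T1 \<Delta> (h \<otimes> a) | h a. h \<in> cointegral_space \<Delta> S} \<subseteq> ?V"
    unfolding left_leg_def by (intro Inter_lower) (auto intro: cvec.subspace_span)
  then have "?V = UNIV" using discrete by (auto simp: discrete_type_def)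
  moreover have "finite B" using fin_C P(1) by (simp add: B_def)
  ultimately show ?thesis by blast
qed

end

theorem proposition4p25:
  fixes \<Delta> :: "'a::complex_algebra \<Rightarrow> ('a \<otimes> 'a) multiplier"
    and \<epsilon> :: "'a \<Rightarrow> complex"
    and E :: "('a \<otimes> 'a) multiplier"
    and G1 G2 :: "'a \<otimes> 'a \<Rightarrow> 'a \<otimes> 'a"
    and S :: "'a \<Rightarrow> 'a multiplier"
  assumes "regular_weak_multiplier_hopf_algebra \<Delta> \<epsilon> E G1 G2 S"
    and "compact_type \<Delta> \<epsilon> E G1 G2 S"
    and "discrete_type \<Delta> S"
  shows "\<exists>B :: 'a set. finite B \<and> cvec.span B = UNIV"
proof -
  obtain e :: 'a where e: "\<And>a. e * a = a" "\<And>a. a * e = a"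
    using assms(2) unfolding compact_type_def by blast
  interpret regular_weak_multiplier_hopf_algebra \<Delta> \<epsilon> E G1 G2 S by (rule assms(1))
  interpret unital_regular_weak_multiplier_hopf_algebra \<Delta> \<epsilon> E G1 G2 S e
    by unfold_locales (rule e)+
  show ?thesis
    using finite_dimensional assms(2,3) by (simp add: compact_type_def)
qed

end
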